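(* For a positive integer $m$ let $\boxplus(m)\subset[0,1]^2$ be the self-similar set defined in the context. If $m$ is large enough (i.e. there is $m_0$ such that for every integer $m\ge m_0$), there exists $0<\alpha_1<1$ such that $D_*(\alpha,\boxplus(m))>\frac1m$ (respectively $D_{\underline{B}*}(\alpha,\boxplus(m))>\frac1m$) for every $\alpha\in(\alpha_1,1]$.
   Context: Definition of $\boxplus(m)$: consider the tiling of $[0,1]^2$ by $2^{2m}$ closed squares of side length $2^{-m}$. Omit a square of the tiling if its boundary intersects at least one of the two midsegments of $[0,1]^2$ (the segments $\{1/2\}\times[0,1]$ and $[0,1]\times\{1/2\}$) but does not intersect the sides of $[0,1]^2$. Let $\mathcal{F}_1$ be the set of remaining squares. The maps $z\mapsto 2^{-m}z+v$ taking $[0,1]^2$ onto the squares of $\mathcal{F}_1$ form an iterated function system, and $\boxplus(m)$ is its attractor. For compact $F\subset\mathbb{R}^p$ and $0<\alpha\le1$, $C_1^\alpha(F)$ is the set of $f:F\to\mathbb{R}$ with $|f(a)-f(b)|\le|a-b|^\alpha$ for all $a,b\in F$, with the topology of the supremum norm. For $f:F\to\mathbb{R}$ put $$D_*^f(F)=\sup\{d:\lambda(\{r:\dim_H(f^{-1}(r))\ge d\})>0\},\qquad D_{\underline{B}*}^f(F)=\sup\{d:\lambda(\{r:\underline{\dim}_B(f^{-1}(r))\ge d\})>0\},$$ where $\lambda$ is one-dimensional Lebesgue measure, $\dim_H$ is Hausdorff dimension and $\underline{\dim}_B$ is lower box dimension. Let $\mathfrak{G}_{1,\alpha}(F)$ be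 the collection of dense $G_\delta$ subsets of $C_1^\alpha(F)$, and $$D_*(\alpha,F)=\sup_{\mathcal{G}\in\mathfrak{G}_{1,\alpha}(F)}\inf\{D_*^f(F): f\in\mathcal{G}\},\qquad D_{\underline{B}*}(\alpha,F)=\sup_{\mathcal{G}\in\mathfrak{G}_{1,\alpha}(F)}\inf\{D_{\underline{B}*}^f(F): f\in\mathcal{G}\}.$$ *)

theory Defs
  imports "HOL-Analysis.Analysis"
begin

section \<open>Hausdorff and lower box dimension\<close>

text \<open>The \<open>s\<close>-th power of the diameter, with the convention that a nonempty set has
  \<open>0\<close>-th power \<open>1\<close> and the empty set always contributes \<open>0\<close> (note that \<open>0 powr 0 = 0\<close> in HOL).\<close>

definition diam_pow :: "real \<Rightarrow> 'a::metric_space set \<Rightarrow> ennreal" where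
  "diam_pow s U =
     (if U = {} then 0 else if s = 0 then 1 else ennreal (diameter U powr s))"

definition hausdorff_pre :: "real \<Rightarrow> real \<Rightarrow> 'a::metric_space set \<Rightarrow> ennreal" where
  "hausdorff_pre s \<delta> A =
     (INF U \<in> {U :: nat \<Rightarrow> 'a set.
                 A \<subseteq> (\<Union>n. U n) \<and> (\<forall>n. bounded (U n) \<and> diameter (U n) \<le> \<delta>)}.
        (\<Sum>n. diam_pow s (U n)))"

definition hausdorff_measure :: "real \<Rightarrow> 'a::metric_space set \<Rightarrow> ennreal" where
  "hausdorff_measure s A = (SUP \<delta>\<in>{0<..}. hausdorff_pre s \<delta> A)"

definition hausdorff_dim :: "'a::metric_space set \<Rightarrow> ereal" where
  "hausdorff_dim A = (INF s \<in> {s. 0 \<le> s \<and> hausdorff_measure s A = 0}. ereal s)"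

text \<open>Meant for totally bounded \<open>A\<close> and \<open>\<delta> > 0\<close>, where a finite cover exists.\<close>

definition covering_number :: "real \<Rightarrow> 'a::metric_space set \<Rightarrow> nat" where
  "covering_number \<delta> A =
     (LEAST n. \<exists>C. finite C \<and> card C = n \<and> A \<subseteq> \<Union>C \<and>
                   (\<forall>U\<in>C. bounded U \<and> diameter U \<le> \<delta>))"

text \<open>As for the Hausdorff dimension, the empty set has dimension \<open>0\<close>.\<close>

definition lower_box_dim :: "'a::metric_space set \<Rightarrow> ereal" where
  "lower_box_dim A =
     (if A = {} then 0
      else Liminf (at_right 0)
             (\<lambda>\<delta>. ereal (ln (real (covering_number \<delta> A)) / - ln \<delta>)))"


section \<open>Hoelder spaces and dimensions of generic level sets\<close>

text \<open>Functions on \<open>F\<close> are represented by functions that are \<open>undefined\<close> outside \<open>F\<close>;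
  \<^const>\<open>funspace\<close> carries the supremum metric on the bounded ones, and for compact \<open>F\<close> all
  Hoelder functions are bounded.\<close>

definition holder_space ::
    "real \<Rightarrow> 'a::euclidean_space set \<Rightarrow> ('a \<Rightarrow> real) metric" where
  "holder_space \<alpha> F =
     submetric (funspace F euclidean_metric)
       {f. \<forall>a\<in>F. \<forall>b\<in>F. \<bar>f a - f b\<bar> \<le> dist a b powr \<alpha>}"

definition dense_gdeltas ::
    "real \<Rightarrow> 'a::euclidean_space set \<Rightarrow> ('a \<Rightarrow> real) set set" where
  "dense_gdeltas \<alpha> F =
     {G. gdelta_in (mtopology_of (holder_space \<alpha> F)) G \<and>
         mtopology_of (holder_space \<alpha> F) closure_of G = mspace (holder_space \<alpha> F)}"

definition level_set :: "('a \<Rightarrow> real) \<Rightarrow> 'a set \<Rightarrow> real \<Rightarrow> 'a set" where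
  "level_set f F r = {x\<in>F. f x = r}"

definition level_dim ::
    "('a set \<Rightarrow> ereal) \<Rightarrow> ('a \<Rightarrow> real) \<Rightarrow> 'a::euclidean_space set \<Rightarrow> ereal" where
  "level_dim D f F =
     Sup {ereal d | d::real. emeasure lebesgue {r::real. D (level_set f F r) \<ge> ereal d} > 0}"

definition generic_level_dim ::
    "('a set \<Rightarrow> ereal) \<Rightarrow> real \<Rightarrow> 'a::euclidean_space set \<Rightarrow> ereal" where
  "generic_level_dim D \<alpha> F = (SUP G\<in>dense_gdeltas \<alpha> F. INF f\<in>G. level_dim D f F)"

text \<open>$D_*(\alpha,F)$ and $D_{\underline{B}*}(\alpha,F)$\<close>

definition D_hausdorff :: "real \<Rightarrow> 'a::euclidean_space set \<Rightarrow> ereal" where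
  "D_hausdorff = generic_level_dim hausdorff_dim"

definition D_lower_box :: "real \<Rightarrow> 'a::euclidean_space set \<Rightarrow> ereal" where
  "D_lower_box = generic_level_dim lower_box_dim"


section \<open>The fractals \<open>\<boxplus>(m)\<close>\<close>

text \<open>The plane is \<^typ>\<open>real \<times> real\<close>, whose metric is the Euclidean one.\<close>

definition attractor :: "('a::metric_space \<Rightarrow> 'a) set \<Rightarrow> 'a set" where
  "attractor \<Phi> = (THE A. compact A \<and> A \<noteq> {} \<and> A = (\<Union>\<phi>\<in>\<Phi>. \<phi> ` A))"

definition unit_square :: "(real \<times> real) set" where
  "unit_square = {0..1} \<times> {0..1}"

definition midsegments :: "(real \<times> real) set" where
  "midsegments = {1/2} \<times> {0..1} \<union> {0..1} \<times> {1/2}"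

definition tile :: "nat \<Rightarrow> nat \<Rightarrow> nat \<Rightarrow> (real \<times> real) set" where
  "tile m i j = {real i / 2^m .. real (Suc i) / 2^m} \<times> {real j / 2^m .. real (Suc j) / 2^m}"

definition tiling :: "nat \<Rightarrow> (real \<times> real) set set" where
  "tiling m = {tile m i j | i j. i < 2^m \<and> j < 2^m}"

definition remaining_tiles :: "nat \<Rightarrow> (real \<times> real) set set" where
  "remaining_tiles m =
     {Q \<in> tiling m. \<not> (frontier Q \<inter> midsegments \<noteq> {} \<and> frontier Q \<inter> frontier unit_square = {})}"

definition boxplus_ifs :: "nat \<Rightarrow> (real \<times> real \<Rightarrow> real \<times> real) set" where
  "boxplus_ifs m =
     {\<phi>. \<exists>v. \<phi> = (\<lambda>z. (1 / 2^m) *\<^sub>R z + v) \<and> \<phi> ` unit_square \<in> remaining_tiles m}"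

definition boxplus :: "nat \<Rightarrow> (real \<times> real) set" where
  "boxplus m = attractor (boxplus_ifs m)"

end

theory Submission
  imports Defs
begin

text \<open>Write \<open>n = 2^m\<close>. Fix \<open>f\<close> with \<open>f (0, 0) \<noteq> f (1, 0)\<close>; these functions form an open dense set. Say that a
  value \<open>r\<close> crosses a square if it separates the values of \<open>f\<close> at its four corners. If \<open>r\<close> crosses a
  square, it crosses at least two of its sides, and near a place where it crosses a side it meets two
  subsquares, unless this place is one of at most 40 bad subsquares (at the ends of the sides or next
  to the bridges). So either a bad subsquare or at least four subsquares near the boundary are
  crossed. Give weight 1 to bad subsquares and weight 1/4 to the others: the mass of the
  crossed squares then never decreases from one level to the next.

  A square of level \<open>k\<close> is crossed by a set of values of measure \<open>O(n^(-k \<alpha>))\<close>, and there are few words with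
  more than a quarter of bad letters. Hence for \<open>\<alpha>\<close> near 1 and \<open>m\<close> large such words carry mass that is
  summable over the levels, for almost every \<open>r\<close>. The other words of length \<open>k\<close> have mass at most
  \<open>4^(-3k/4) = n^(-k d)\<close> with \<open>d = 3/(2m) > 1/m\<close>, so the level set has dimension at least \<open>d\<close> by the mass
  distribution principle.

  The set of values \<open>r\<close> with a level set of dimension at least \<open>d\<close> has to be Lebesgue measurable. As the
  remaining squares are connected along their edges, every \<open>r\<close> strictly between the extreme values of \<open>f\<close>
  crosses some square, so this set is an interval up to a null set.\<close>

section \<open>Hausdorff and box dimension\<close>

lemma diameter_le_dist:
  fixes S :: "'a::metric_space set"
  assumes "0 \<le> \<delta>" "\<And>x y. x \<in> S \<Longrightarrow> y \<in> S \<Longrightarrow> dist x y \<le> \<delta>"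
  shows "diameter S \<le> \<delta>"
  using assms by (auto simp: diameter_def intro!: cSUP_least)

lemma hausdorff_pre_le:
  assumes "A \<subseteq> (\<Union>n. U n)" "\<And>n. bounded (U n)" "\<And>n. diameter (U n) \<le> \<delta>"
  shows "hausdorff_pre s \<delta> A \<le> (\<Sum>n. diam_pow s (U n))"
  unfolding hausdorff_pre_def by (rule INF_lower) (use assms in auto)

lemma hausdorff_measure_eq_0_iff:
  "hausdorff_measure s A = 0 \<longleftrightarrow> (\<forall>\<delta>>0. hausdorff_pre s \<delta> A = 0)"
proof -
  have "hausdorff_measure s A = 0 \<longleftrightarrow> hausdorff_measure s A \<le> 0"
    by simp
  also have "\<dots> \<longleftrightarrow> (\<forall>\<delta>>0. hausdorff_pre s \<delta> A \<le> 0)"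
    unfolding hausdorff_measure_def by (auto simp only: SUP_le_iff greaterThan_iff Ball_def)
  finally show ?thesis by simp
qed

lemma hausdorff_dim_le:
  assumes "0 \<le> s" "hausdorff_measure s A = 0"
  shows "hausdorff_dim A \<le> ereal s"
  unfolding hausdorff_dim_def by (rule INF_lower) (use assms in auto)

lemma hausdorff_dim_empty: "hausdorff_dim ({} :: 'a::metric_space set) = 0"
proof (rule antisym)
  have "hausdorff_measure 0 ({} :: 'a set) = 0"
    unfolding hausdorff_measure_eq_0_iff
  proof (intro allI impI)
    fix \<delta> :: real assume "0 < \<delta>"
    then have "hausdorff_pre 0 \<delta> ({} :: 'a set) \<le> (\<Sum>n::nat. diam_pow 0 ({} :: 'a set))"
      by (intro hausdorff_pre_le) auto
    then show "hausdorff_pre 0 \<delta> ({} :: 'a set) = 0"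
      by (simp add: diam_pow_def)
  qed
  from hausdorff_dim_le[OF _ this] show "hausdorff_dim ({} :: 'a set) \<le> 0"
    by (simp add: zero_ereal_def)
  show "0 \<le> hausdorff_dim ({} :: 'a set)"
    unfolding hausdorff_dim_def by (rule INF_greatest) (auto simp: zero_ereal_def)
qed

text \<open>A cover of \<open>B\<close> pulls back along \<open>g\<close> to a cover of
  \<open>A\<close> whose diameters grow by a factor of at most \<open>C\<close>. The sums with
  exponent \<open>s\<close> grow by at most \<open>C powr s\<close>, so vanishing measure is
  inherited by \<open>A\<close>.\<close>

lemma hausdorff_dim_le_image:
  fixes g :: "'a::metric_space \<Rightarrow> 'b::metric_space"
  assumes g: "g ` A \<subseteq> B" and C: "0 < C"
    and exp: "\<And>x y. x \<in> A \<Longrightarrow> y \<in> A \<Longrightarrow> dist x y \<le> C * dist (g x) (g y)"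
  shows "hausdorff_dim A \<le> hausdorff_dim B"
proof -
  have pull: "bounded (A \<inter> g -` V)" "diameter (A \<inter> g -` V) \<le> C * diameter V"
    "diam_pow s (A \<inter> g -` V) \<le> ennreal (C powr s) * diam_pow s V"
    if V: "bounded V" and s: "0 \<le> s" for V s
  proof -
    have d: "dist x y \<le> C * diameter V" if "x \<in> A \<inter> g -` V" "y \<in> A \<inter> g -` V" for x y
    proof -
      have "dist (g x) (g y) \<le> diameter V"
        using that V by (intro diameter_bounded_bound) auto
      then have "C * dist (g x) (g y) \<le> C * diameter V"
        using C by simp
      then show ?thesis using exp[of x y] that by auto
    qed
    show b: "bounded (A \<inter> g -` V)"
      unfolding bounded_two_points using d by blast
    show dl: "diameter (A \<inter> g -` V) \<le> C * diameter V"
      using d C diameter_ge_0[OF V] by (intro diameter_le_dist) auto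
    show "diam_pow s (A \<inter> g -` V) \<le> ennreal (C powr s) * diam_pow s V"
    proof (cases "A \<inter> g -` V = {}")
      case True
      then show ?thesis by (simp add: diam_pow_def)
    next
      case False
      then have "V \<noteq> {}" by auto
      have "diameter (A \<inter> g -` V) powr s \<le> (C * diameter V) powr s"
        using dl s diameter_ge_0[OF b] by (intro powr_mono2) auto
      also have "\<dots> = C powr s * diameter V powr s"
        using C diameter_ge_0[OF V] by (simp add: powr_mult)
      finally show ?thesis
        using False \<open>V \<noteq> {}\<close> C by (auto simp: diam_pow_def simp flip: ennreal_mult intro!: ennreal_leI)
    qed
  qed
  show ?thesis
    unfolding hausdorff_dim_def[of B]
  proof (rule INF_greatest)
    fix s assume "s \<in> {s. 0 \<le> s \<and> hausdorff_measure s B = 0}"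
    then have s: "0 \<le> s" and B0: "\<And>\<delta>. 0 < \<delta> \<Longrightarrow> hausdorff_pre s \<delta> B = 0"
      by (auto simp: hausdorff_measure_eq_0_iff)
    have "hausdorff_pre s \<delta> A \<le> 0 + ennreal e" if "0 < \<delta>" "0 < e" for \<delta> e
    proof -
      have "hausdorff_pre s (\<delta> / C) B < ennreal (e / C powr s)"
        using B0[of "\<delta> / C"] C that by simp
      then obtain U :: "nat \<Rightarrow> 'b set" where U: "B \<subseteq> (\<Union>n. U n)" "\<And>n. bounded (U n)"
        "\<And>n. diameter (U n) \<le> \<delta> / C" and sum: "(\<Sum>n. diam_pow s (U n)) < ennreal (e / C powr s)"
        unfolding hausdorff_pre_def INF_less_iff by auto
      have "hausdorff_pre s \<delta> A \<le> (\<Sum>n. diam_pow s (A \<inter> g -` U n))"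
      proof (rule hausdorff_pre_le)
        show "A \<subseteq> (\<Union>n. A \<inter> g -` U n)" using g U(1) by blast
        show "bounded (A \<inter> g -` U n)" for n using pull(1)[OF U(2) s] .
        have "C * diameter (U n) \<le> \<delta>" for n
          using U(3)[of n] C by (simp add: field_simps)
        then show "diameter (A \<inter> g -` U n) \<le> \<delta>" for n
          using pull(2)[OF U(2) s, of n] order_trans by blast
      qed
      also have "\<dots> \<le> (\<Sum>n. ennreal (C powr s) * diam_pow s (U n))"
        using pull(3)[OF U(2) s] by (intro suminf_le) auto
      also have "\<dots> = ennreal (C powr s) * (\<Sum>n. diam_pow s (U n))"
        by simp
      also have "\<dots> \<le> ennreal (C powr s) * ennreal (e / C powr s)"
        using sum by (intro mult_left_mono) auto
      also have "\<dots> = ennreal e"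
        using C that by (simp flip: ennreal_mult)
      finally show ?thesis by simp
    qed
    then have "hausdorff_pre s \<delta> A \<le> 0" if "0 < \<delta>" for \<delta>
      using that by (metis ennreal_le_epsilon)
    then have "hausdorff_measure s A = 0"
      by (simp add: hausdorff_measure_eq_0_iff)
    then show "hausdorff_dim A \<le> ereal s"
      using s by (rule hausdorff_dim_le[rotated])
  qed
qed

text \<open>Right continuity of the power, valid at \<open>D = 0\<close> as well because
  \<open>d > 0\<close>. It allows the sets of a cover to be thickened to open sets at an arbitrarily
  small cost in the sum of powers.\<close>

lemma powr_perturb:
  fixes D d \<epsilon> \<rho> :: real
  assumes "0 \<le> D" "0 < d" "0 < \<epsilon>" "0 < \<rho>"
  obtains t where "0 < t" "t < \<rho>" "(D + t) powr d < D powr d + \<epsilon>"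
proof -
  have "((\<lambda>t. (D + t) powr d) \<longlongrightarrow> (D + 0) powr d) (at_right 0)"
    by (rule tendsto_powr2) (use assms in \<open>auto intro!: tendsto_eq_intros eventually_at_right_less simp: eventually_at_filter\<close>)
  then have "eventually (\<lambda>t. (D + t) powr d < D powr d + \<epsilon>) (at_right 0)"
    using assms by (intro order_tendstoD(2)[where a = "D powr d + \<epsilon>"]) auto
  moreover have "eventually (\<lambda>t. 0 < t \<and> t < \<rho>) (at_right (0::real))"
    using eventually_at_right_real[OF assms(4)] by simp
  ultimately have "eventually (\<lambda>t. 0 < t \<and> t < \<rho> \<and> (D + t) powr d < D powr d + \<epsilon>) (at_right 0)"
    by eventually_elim auto
  then obtain t where "0 < t \<and> t < \<rho> \<and> (D + t) powr d < D powr d + \<epsilon>"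
    using eventually_happens'[of "at_right (0::real)"] by (auto simp: trivial_limit_at_right_real)
  then show ?thesis using that by blast
qed

text \<open>A form of the mass distribution principle for compact sets in which only finite covers
  are tested and \<open>D i\<close> is a positive bound on distances in place of the diameter. If
  the measure with some exponent \<open>s < d\<close> vanished, a cheap countable cover could be
  made open, reduced to a finite one by compactness, and would violate the bound
  \<open>c\<close>.\<close>

lemma hausdorff_dim_ge:
  fixes A :: "'a::metric_space set"
  assumes A: "compact A" and c: "0 < c" and \<delta>: "0 < \<delta>" and d: "0 < d"
    and fin: "\<And>(I::nat set) V D. finite I \<Longrightarrow> A \<subseteq> (\<Union>i\<in>I. V i) \<Longrightarrow>
       (\<And>i. i \<in> I \<Longrightarrow> 0 < D i \<and> D i < \<delta> \<and> (\<forall>x\<in>V i. \<forall>y\<in>V i. dist x y \<le> D i)) \<Longrightarrow>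
       c \<le> (\<Sum>i\<in>I. D i powr d)"
  shows "ereal d \<le> hausdorff_dim A"
  unfolding hausdorff_dim_def
proof (rule INF_greatest)
  fix s assume "s \<in> {s. 0 \<le> s \<and> hausdorff_measure s A = 0}"
  then have s: "0 \<le> s" and pre0: "\<And>\<delta>. 0 < \<delta> \<Longrightarrow> hausdorff_pre s \<delta> A = 0"
    by (auto simp: hausdorff_measure_eq_0_iff)
  show "ereal d \<le> ereal s"
  proof (rule ccontr)
    assume "\<not> ereal d \<le> ereal s"
    then have sd: "s < d" by simp
    \<comment> \<open>The bound \<open>\<delta>/2\<close> leaves room for thickening below
      \<open>\<delta>\<close>. The bound \<open>1/2\<close> keeps diameters below 1, where the power
      with exponent \<open>d\<close> is at most the one with \<open>s < d\<close>.\<close>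
    have "hausdorff_pre s (min (\<delta>/2) (1/2)) A < ennreal (c/2)"
      using pre0[of "min (\<delta>/2) (1/2)"] c \<delta> by simp
    then obtain U :: "nat \<Rightarrow> 'a set" where U: "A \<subseteq> (\<Union>n. U n)" "\<And>n. bounded (U n)"
        "\<And>n. diameter (U n) \<le> min (\<delta>/2) (1/2)" and sum: "(\<Sum>n. diam_pow s (U n)) < ennreal (c/2)"
      unfolding hausdorff_pre_def INF_less_iff by auto
    have D0: "0 \<le> diameter (U n)" for n by (rule diameter_ge_0[OF U(2)])
    \<comment> \<open>The allowances \<open>c/4 * (1/2)^n\<close> add up to \<open>c/2\<close>, so
      the original cover still has to pay the other half of \<open>c\<close>.\<close>
    have "\<exists>t. 0 < t \<and> t < \<delta>/2 \<and> (diameter (U n) + t) powr d < diameter (U n) powr d + c/4 * (1/2)^n" for n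
      using powr_perturb[OF D0 d, of "c/4 * (1/2)^n" "\<delta>/2"] c \<delta> by (metis divide_pos_pos mult_pos_pos zero_less_numeral zero_less_power zero_less_one)
    then obtain t where t: "\<And>n. 0 < t n" "\<And>n. t n < \<delta>/2"
      "\<And>n. (diameter (U n) + t n) powr d < diameter (U n) powr d + c/4 * (1/2)^n" by metis
    define V where "V n = (\<Union>x\<in>U n. ball x (t n / 2))" for n
    have Vop: "open (V n)" for n unfolding V_def by auto
    have UV: "U n \<subseteq> V n" for n unfolding V_def using t(1)[of n] by auto
    have "A \<subseteq> (\<Union>n\<in>UNIV. V n)" using U(1) UV by blast
    then obtain I where I: "finite I" "A \<subseteq> (\<Union>n\<in>I. V n)"
      using compactE_image[OF A, of UNIV V] Vop by auto
    define J where "J = {n\<in>I. U n \<noteq> {}}"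
    have J: "finite J" "A \<subseteq> (\<Union>n\<in>J. V n)"
      using I by (fastforce simp: J_def V_def)+
    have "c \<le> (\<Sum>i\<in>J. (diameter (U i) + t i) powr d)"
    proof (rule fin[OF J])
      fix i assume "i \<in> J"
      show "0 < diameter (U i) + t i \<and> diameter (U i) + t i < \<delta> \<and>
          (\<forall>x\<in>V i. \<forall>y\<in>V i. dist x y \<le> diameter (U i) + t i)"
      proof (intro conjI ballI)
        show "0 < diameter (U i) + t i" using t(1)[of i] D0[of i] by linarith
        show "diameter (U i) + t i < \<delta>" using t(2)[of i] U(3)[of i] by auto
        fix x y assume "x \<in> V i" "y \<in> V i"
        then obtain a b where ab: "a \<in> U i" "b \<in> U i" "dist a x < t i / 2" "dist b y < t i / 2"
          by (auto simp: V_def)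
        have "dist a b \<le> diameter (U i)"
          using ab U(2) by (intro diameter_bounded_bound) auto
        then show "dist x y \<le> diameter (U i) + t i"
          using ab dist_triangle[of x y a] dist_triangle[of a y b] by (simp add: dist_commute)
      qed
    qed
    also have "\<dots> \<le> (\<Sum>i\<in>J. diameter (U i) powr d + c/4 * (1/2)^i)"
      using t(3) by (intro sum_mono) (simp add: less_imp_le)
    also have "\<dots> = (\<Sum>i\<in>J. diameter (U i) powr d) + c/4 * (\<Sum>i\<in>J. (1/2)^i)"
      by (simp add: sum.distrib sum_distrib_left)
    also have "(\<Sum>i\<in>J. (1/2)^i) \<le> (\<Sum>i. (1/2::real)^i)"
      using J by (intro sum_le_suminf) (auto simp: summable_geometric)
    also have "(\<Sum>i. (1/2::real)^i) = 2"
      by (subst suminf_geometric) auto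
    finally have "c/2 \<le> (\<Sum>i\<in>J. diameter (U i) powr d)"
      using c by simp
    then have "ennreal (c/2) \<le> ennreal (\<Sum>i\<in>J. diameter (U i) powr d)"
      by (rule ennreal_leI)
    also have "\<dots> = (\<Sum>i\<in>J. ennreal (diameter (U i) powr d))"
      by (subst sum_ennreal) auto
    also have "\<dots> \<le> (\<Sum>i\<in>J. diam_pow s (U i))"
    proof (rule sum_mono)
      fix i assume "i \<in> J"
      then have ne: "U i \<noteq> {}" by (auto simp: J_def)
      have D1: "diameter (U i) \<le> 1" using U(3)[of i] by auto
      have "diameter (U i) powr d \<le> 1" using D0[of i] D1 d by (simp add: powr_le1)
      moreover have "diameter (U i) powr d \<le> diameter (U i) powr s"
        using D0[of i] D1 sd by (intro powr_mono') auto
      ultimately show "ennreal (diameter (U i) powr d) \<le> diam_pow s (U i)"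
        using ne by (auto simp: diam_pow_def intro: ennreal_leI)
    qed
    also have "\<dots> \<le> (\<Sum>i. diam_pow s (U i))"
      using J by (intro sum_le_suminf) auto
    finally show False using sum by (simp add: not_less)
  qed
qed

section \<open>Comparison of Hausdorff and lower box dimension\<close>

lemma covering_number_witness:
  fixes A :: "'a::euclidean_space set"
  assumes A: "bounded A" and \<delta>: "0 < \<delta>"
  obtains C where "finite C" "card C = covering_number \<delta> A" "A \<subseteq> \<Union>C"
    "\<forall>U\<in>C. bounded U \<and> diameter U \<le> \<delta>"
proof -
  let ?P = "\<lambda>n. \<exists>C. finite C \<and> card C = n \<and> A \<subseteq> \<Union>C \<and> (\<forall>U\<in>C. bounded U \<and> diameter U \<le> \<delta>)"
  have "compact (closure A)" using A by simp
  then obtain K where K: "finite K" "closure A \<subseteq> (\<Union>x\<in>K. ball x (\<delta>/2))"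
    using compactE_image[of "closure A" UNIV "\<lambda>x. ball x (\<delta>/2)"] \<delta>
    by (metis UNIV_I UN_I centre_in_ball half_gt_zero open_ball subsetI)
  have "?P (card ((\<lambda>x. ball x (\<delta>/2)) ` K))"
  proof (intro exI[of _ "(\<lambda>x. ball x (\<delta>/2)) ` K"] conjI ballI)
    show "A \<subseteq> \<Union> ((\<lambda>x. ball x (\<delta>/2)) ` K)" using K(2) closure_subset by blast
  next
    fix U assume "U \<in> (\<lambda>x. ball x (\<delta>/2)) ` K"
    then show "bounded U" "diameter U \<le> \<delta>" using \<delta> by auto
  qed (use K in auto)
  then have "?P (covering_number \<delta> A)"
    unfolding covering_number_def by (rule LeastI)
  then show ?thesis using that by blast
qed

text \<open>Take \<open>y < y1 < y2\<close> below the Hausdorff dimension. Some pre-measure with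
  exponent \<open>y2\<close> exceeds a positive \<open>e\<close>, and a cover by \<open>N\<close>
  sets of diameter at most \<open>\<delta>\<close> gives \<open>e < N * \<delta> powr y2\<close>.
  For small \<open>\<delta>\<close> the number \<open>e\<close> is larger than
  \<open>\<delta> powr (y2 - y1)\<close>, whence \<open>N > \<delta> powr (- y1)\<close>.\<close>

lemma hausdorff_dim_le_lower_box_dim:
  fixes A :: "'a::euclidean_space set"
  assumes A: "bounded A" "A \<noteq> {}"
  shows "hausdorff_dim A \<le> lower_box_dim A"
proof -
  have "hausdorff_dim A \<le> Liminf (at_right 0)
      (\<lambda>\<delta>. ereal (ln (real (covering_number \<delta> A)) / - ln \<delta>))"
    unfolding le_Liminf_iff
  proof (intro allI impI)
    fix y assume y: "y < hausdorff_dim A"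
    show "eventually (\<lambda>\<delta>. y < ereal (ln (real (covering_number \<delta> A)) / - ln \<delta>)) (at_right 0)"
    \<comment> \<open>For \<open>y < 0\<close> it is enough that the quotient is nonnegative once
      \<open>\<delta> < 1\<close>. Otherwise \<open>y2\<close> is nonnegative and thus an admissible
      exponent.\<close>
    proof (cases "y < 0")
      case True
      have "eventually (\<lambda>\<delta>::real. 0 < \<delta> \<and> \<delta> < 1) (at_right 0)"
        using eventually_at_right_real[of 0 "1::real"] by simp
      then show ?thesis
      proof eventually_elim
        case (elim \<delta>)
        have "0 < \<delta>" using elim by simp
        obtain C where C: "finite C" "card C = covering_number \<delta> A" "A \<subseteq> \<Union>C"
          and CU: "\<forall>U\<in>C. bounded U \<and> diameter U \<le> \<delta>"
          by (rule covering_number_witness[OF A(1) \<open>0 < \<delta>\<close>])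
        then have "C \<noteq> {}" using A(2) by auto
        then have "1 \<le> real (covering_number \<delta> A)" using C(1) by (simp add: C(2)[symmetric] Suc_le_eq card_gt_0_iff)
        then have "0 \<le> ln (real (covering_number \<delta> A)) / - ln \<delta>"
          using elim by (intro divide_nonneg_pos) auto
        then have "0 \<le> ereal (ln (real (covering_number \<delta> A)) / - ln \<delta>)"
          by simp
        then show ?case using True by order
      qed
    next
      case False
      then have "0 \<le> y" by simp
      obtain y1 where y1: "y < ereal y1" "ereal y1 < hausdorff_dim A" using ereal_dense2[OF y] by blast
      obtain y2 where y2: "y1 < y2" "ereal y2 < hausdorff_dim A" using ereal_dense2[OF y1(2)] by auto
      have pos: "0 < y1" "0 \<le> y2" using \<open>0 \<le> y\<close> y1 y2 by (auto simp: zero_ereal_def dest: order.strict_trans1)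
      have "hausdorff_measure y2 A \<noteq> 0"
        using hausdorff_dim_le[OF pos(2), of A] y2(2) by auto
      then obtain \<delta>0 where \<delta>0: "0 < \<delta>0" "hausdorff_pre y2 \<delta>0 A \<noteq> 0"
        by (auto simp: hausdorff_measure_eq_0_iff)
      have "0 < hausdorff_pre y2 \<delta>0 A" using \<delta>0(2) by (simp add: zero_less_iff_neq_zero)
      then obtain q :: rat where "0 < real_of_rat q" "ennreal (real_of_rat q) < hausdorff_pre y2 \<delta>0 A"
        using ennreal_rat_dense[of 0] by (metis ennreal_0 ennreal_less_zero_iff ennreal_neg not_le)
      then obtain e where e: "0 < e" "ennreal e < hausdorff_pre y2 \<delta>0 A" by blast
      have "((\<lambda>\<delta>. \<delta> powr (y2 - y1)) \<longlongrightarrow> 0) (at_right (0::real))"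
        using y2(1) by (intro tendsto_eq_intros tendsto_zero_powrI) (auto intro!: tendsto_eq_intros simp: eventually_at_filter)
      then have "eventually (\<lambda>\<delta>. \<delta> powr (y2 - y1) < e) (at_right (0::real))"
        using e(1) by (rule order_tendstoD)
      moreover have "eventually (\<lambda>\<delta>::real. 0 < \<delta> \<and> \<delta> < min 1 \<delta>0) (at_right 0)"
        using eventually_at_right_real[of 0 "min 1 \<delta>0"] \<delta>0(1) by simp
      ultimately show ?thesis
      proof eventually_elim
        case (elim \<delta>)
        have "0 < \<delta>" using elim by simp
        obtain C where C: "finite C" "card C = covering_number \<delta> A" "A \<subseteq> \<Union>C"
          and CU: "\<forall>U\<in>C. bounded U \<and> diameter U \<le> \<delta>"
          by (rule covering_number_witness[OF A(1) \<open>0 < \<delta>\<close>])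
        obtain u where u: "bij_betw u {..<card C} C"
          using ex_bij_betw_nat_finite[OF C(1)] by (auto simp: atLeast0LessThan)
        define U where "U n = (if n < card C then u n else {})" for n
        have UC: "n < card C \<Longrightarrow> u n \<in> C" for n using u by (auto simp: bij_betw_def)
        have "hausdorff_pre y2 \<delta>0 A \<le> (\<Sum>n. diam_pow y2 (U n))"
        proof (rule hausdorff_pre_le)
          show "A \<subseteq> (\<Union>n. U n)"
          proof
            fix x assume "x \<in> A"
            then obtain V where "V \<in> C" "x \<in> V" using C(3) by blast
            then obtain n where "n < card C" "u n = V"
              using u by (metis bij_betw_imp_surj_on imageE lessThan_iff)
            then show "x \<in> (\<Union>n. U n)" using \<open>x \<in> V\<close> by (auto simp: U_def intro!: exI[of _ n])
          qed
          show "bounded (U n)" "diameter (U n) \<le> \<delta>0" for n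
            using UC[of n] CU \<delta>0(1) elim by (auto simp: U_def intro: order.trans[of _ \<delta>])
        qed
        also have "\<dots> = (\<Sum>n<card C. diam_pow y2 (U n))"
          by (rule suminf_finite) (auto simp: U_def diam_pow_def)
        also have "\<dots> \<le> (\<Sum>n<card C. ennreal (\<delta> powr y2))"
        proof (rule sum_mono)
          fix n assume "n \<in> {..<card C}"
          then have "bounded (U n)" "diameter (U n) \<le> \<delta>"
            using UC[of n] CU by (auto simp: U_def)
          then have "diameter (U n) powr y2 \<le> \<delta> powr y2"
            using pos diameter_ge_0 by (intro powr_mono2) auto
          then show "diam_pow y2 (U n) \<le> ennreal (\<delta> powr y2)"
            using pos y2 by (auto simp: diam_pow_def intro: ennreal_leI)
        qed
        also have "\<dots> = ennreal (real (covering_number \<delta> A) * \<delta> powr y2)"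
          by (simp add: C(2) ennreal_mult ennreal_of_nat_eq_real_of_nat)
        finally have "ennreal e < ennreal (real (covering_number \<delta> A) * \<delta> powr y2)"
          using e(2) by simp
        then have "e < real (covering_number \<delta> A) * \<delta> powr y2"
          by (simp add: ennreal_less_iff e(1) less_imp_le)
        then have "\<delta> powr (y2 - y1) < real (covering_number \<delta> A) * \<delta> powr y2"
          using elim by simp
        then have N: "\<delta> powr (- y1) < real (covering_number \<delta> A)"
          using elim by (simp add: powr_diff powr_minus field_simps)
        then have "ln (\<delta> powr (- y1)) < ln (real (covering_number \<delta> A))"
          using elim by (intro ln_less_cancel_iff[THEN iffD2])
            (auto intro: order.strict_trans[OF _ N] simp del: of_nat_0_less_iff)
        then have "y1 * - ln \<delta> < ln (real (covering_number \<delta> A))"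
          using elim by (simp add: ln_powr)
        then have "y1 < ln (real (covering_number \<delta> A)) / - ln \<delta>"
          using elim by (subst pos_less_divide_eq) auto
        then show ?case using y1(1) by (meson ereal_less(2) less_ereal.simps(1) order.strict_trans)
      qed
    qed
  qed
  then show ?thesis using A(2) by (simp add: lower_box_dim_def)
qed


section \<open>Attractors of similarity systems\<close>

text \<open>A point of \<open>A\<close> is reached by \<open>k\<close> maps from another point of
  \<open>A\<close>. The same maps applied to a point of \<open>B\<close> end in \<open>B\<close>,
  and each of them shrinks the distance by the factor \<open>c\<close>.\<close>

lemma attractor_dist_le:
  fixes \<Phi> :: "('a::metric_space \<Rightarrow> 'a) set"
  assumes c: "0 \<le> c" and lip: "\<And>\<phi> x y. \<phi> \<in> \<Phi> \<Longrightarrow> dist (\<phi> x) (\<phi> y) \<le> c * dist x y"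
    and A: "A = (\<Union>\<phi>\<in>\<Phi>. \<phi> ` A)" "\<And>a b. a \<in> A \<Longrightarrow> b \<in> B \<Longrightarrow> dist a b \<le> M"
    and B: "B = (\<Union>\<phi>\<in>\<Phi>. \<phi> ` B)" "B \<noteq> {}" and a: "a \<in> A"
  shows "\<exists>b\<in>B. dist a b \<le> c ^ k * M"
  using a
proof (induction k arbitrary: a)
  case 0
  then show ?case using A(2) B(2) by fastforce
next
  case (Suc k)
  obtain \<phi> a' where a': "\<phi> \<in> \<Phi>" "a' \<in> A" "a = \<phi> a'"
    using Suc.prems A(1) by blast
  obtain b' where b': "b' \<in> B" "dist a' b' \<le> c ^ k * M"
    using Suc.IH[OF a'(2)] by blast
  have "dist a (\<phi> b') \<le> c * dist a' b'" using lip a' by simp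
  also have "\<dots> \<le> c * (c ^ k * M)" using b'(2) c by (rule mult_left_mono)
  finally have "dist a (\<phi> b') \<le> c ^ Suc k * M" by (simp add: mult_ac)
  moreover have "\<phi> b' \<in> B" using B(1) a'(1) b'(1) by blast
  ultimately show ?case by blast
qed

lemma attractor_unique:
  fixes \<Phi> :: "('a::metric_space \<Rightarrow> 'a) set"
  assumes c: "0 \<le> c" "c < 1" and lip: "\<And>\<phi> x y. \<phi> \<in> \<Phi> \<Longrightarrow> dist (\<phi> x) (\<phi> y) \<le> c * dist x y"
    and A: "compact A" "A \<noteq> {}" "A = (\<Union>\<phi>\<in>\<Phi>. \<phi> ` A)"
    and B: "compact B" "B \<noteq> {}" "B = (\<Union>\<phi>\<in>\<Phi>. \<phi> ` B)"
  shows "A = B"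
proof -
  have sub: "A \<subseteq> B"
    if A: "compact A" "A = (\<Union>\<phi>\<in>\<Phi>. \<phi> ` A)" and B: "compact B" "B \<noteq> {}" "B = (\<Union>\<phi>\<in>\<Phi>. \<phi> ` B)"
    for A B
  proof
    fix a assume a: "a \<in> A"
    have "bounded (A \<union> B)" using A(1) B(1) by (simp add: compact_imp_bounded)
    then obtain M where M: "\<And>a b. a \<in> A \<union> B \<Longrightarrow> b \<in> A \<union> B \<Longrightarrow> dist a b \<le> M"
      unfolding bounded_two_points by blast
    have "\<exists>b\<in>B. dist a b \<le> c ^ k * M" for k
      by (rule attractor_dist_le[OF c(1) lip A(2) _ B(3,2) a]) (use M in auto)
    then have le: "infdist a B \<le> c ^ k * M" for k
      using infdist_le2 by blast
    have "(\<lambda>k. c ^ k * M) \<longlonglongrightarrow> 0 * M"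
      using c by (intro tendsto_mult LIMSEQ_realpow_zero tendsto_const)
    then have "infdist a B \<le> 0 * M"
      by (rule LIMSEQ_le_const) (use le in auto)
    then have "infdist a B = 0" using infdist_nonneg[of a B] by simp
    then show "a \<in> B"
      using in_closed_iff_infdist_zero[of B a] B compact_imp_closed by blast
  qed
  show ?thesis using sub[OF A(1,3) B] sub[OF B(1,3) A] by blast
qed

lemma attractor_exists:
  fixes \<Phi> :: "('a::heine_borel \<Rightarrow> 'a) set"
  assumes fin: "finite \<Phi>" "\<Phi> \<noteq> {}" and cont: "\<And>\<phi>. \<phi> \<in> \<Phi> \<Longrightarrow> continuous_on UNIV \<phi>"
    and inj: "\<And>\<phi>. \<phi> \<in> \<Phi> \<Longrightarrow> inj \<phi>"
    and X: "compact X" "X \<noteq> {}" "\<And>\<phi>. \<phi> \<in> \<Phi> \<Longrightarrow> \<phi> ` X \<subseteq> X"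
  shows "\<exists>A. compact A \<and> A \<noteq> {} \<and> A = (\<Union>\<phi>\<in>\<Phi>. \<phi> ` A) \<and> A \<subseteq> X"
proof -
  define H where "H = (\<lambda>S. \<Union>\<phi>\<in>\<Phi>. \<phi> ` S)"
  define K where "K = (\<lambda>k. (H ^^ k) X)"
  have K0: "K 0 = X" and KS: "K (Suc k) = (\<Union>\<phi>\<in>\<Phi>. \<phi> ` K k)" for k
    by (simp_all add: K_def H_def)
  have Kc: "compact (K k)" for k
  proof (induction k)
    case (Suc k)
    show ?case unfolding KS
      using Suc fin(1) cont by (intro compact_UN compact_continuous_image) (auto intro: continuous_on_subset)
  qed (simp add: K0 X)
  have Kn: "K k \<noteq> {}" for k
    by (induction k) (use fin X in \<open>auto simp: K0 KS\<close>)
  have "K (Suc k) \<subseteq> K k" for k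
  proof (induction k)
    case 0
    show ?case using X(3) by (auto simp: KS K0)
  next
    case (Suc k)
    then show ?case unfolding KS[of "Suc k"] KS[of k] by blast
  qed
  then have dec: "i \<le> j \<Longrightarrow> K j \<subseteq> K i" for i j
    by (rule lift_Suc_antimono_le)
  define A where "A = (\<Inter>k. K k)"
  have "A \<noteq> {}"
    unfolding A_def by (rule compact_nest) (use Kc Kn dec in auto)
  moreover have "compact A"
    unfolding A_def using Kc by (intro compact_Inter) auto
  moreover have "A \<subseteq> X" unfolding A_def using K0 by auto
  moreover have "A = (\<Union>\<phi>\<in>\<Phi>. \<phi> ` A)"
  proof
    show "A \<subseteq> (\<Union>\<phi>\<in>\<Phi>. \<phi> ` A)"
    proof
      fix x assume "x \<in> A"
      then have "\<forall>k. \<exists>\<phi>\<in>\<Phi>. x \<in> \<phi> ` K k"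
        unfolding A_def using KS by blast
      then obtain p where p: "\<And>k. p k \<in> \<Phi>" "\<And>k. x \<in> p k ` K k" by metis
      \<comment> \<open>The map that reaches \<open>x\<close> may change with the level, but one of
        the finitely many maps occurs at infinitely many levels. By injectivity it has a single
        preimage of \<open>x\<close>, which therefore lies in every \<open>K k\<close>.\<close>
      have "\<exists>\<phi>\<in>\<Phi>. infinite {k \<in> UNIV. p k = \<phi>}"
        by (rule pigeonhole_infinite_rel) (use fin p in auto)
      then obtain \<phi> where \<phi>: "\<phi> \<in> \<Phi>" "infinite {k. p k = \<phi>}" by auto
      obtain y where y: "x = \<phi> y"
        using \<phi>(2) p(2) by (metis (mono_tags, lifting) finite.emptyI imageE mem_Collect_eq equals0I)
      have "y \<in> K k" for k
      proof -
        obtain j where "j \<ge> k" "p j = \<phi>"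
          using \<phi>(2) unfolding infinite_nat_iff_unbounded_le by blast
        then show ?thesis
          using p(2)[of j] y inj[OF \<phi>(1)] dec[of k j] by (auto dest: injD)
      qed
      then show "x \<in> (\<Union>\<phi>\<in>\<Phi>. \<phi> ` A)" unfolding A_def using \<phi>(1) y by blast
    qed
    have "\<phi> x \<in> K k" if "\<phi> \<in> \<Phi>" "x \<in> A" for \<phi> x k
    proof -
      have "\<phi> x \<in> K (Suc k)" using that unfolding A_def KS by blast
      then show ?thesis using dec[of k "Suc k"] by auto
    qed
    then show "(\<Union>\<phi>\<in>\<Phi>. \<phi> ` A) \<subseteq> A" unfolding A_def by blast
  qed
  ultimately show ?thesis by blast
qed

text \<open>\<open>attractor\<close> is a definite description, so nothing is known about it until
  existence and uniqueness are combined.\<close>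

lemma attractor_properties:
  fixes \<Phi> :: "('a::heine_borel \<Rightarrow> 'a) set"
  assumes fin: "finite \<Phi>" "\<Phi> \<noteq> {}" and c: "0 < c" "c < 1"
    and sim: "\<And>\<phi> x y. \<phi> \<in> \<Phi> \<Longrightarrow> dist (\<phi> x) (\<phi> y) = c * dist x y"
    and X: "compact X" "X \<noteq> {}" "\<And>\<phi>. \<phi> \<in> \<Phi> \<Longrightarrow> \<phi> ` X \<subseteq> X"
  shows "compact (attractor \<Phi>)" "attractor \<Phi> \<noteq> {}"
    "attractor \<Phi> = (\<Union>\<phi>\<in>\<Phi>. \<phi> ` attractor \<Phi>)" "attractor \<Phi> \<subseteq> X"
proof -
  have "continuous_on UNIV \<phi>" if "\<phi> \<in> \<Phi>" for \<phi>
    using sim[OF that] c by (intro lipschitz_on_continuous_on[of c] lipschitz_onI) auto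
  moreover have "inj \<phi>" if "\<phi> \<in> \<Phi>" for \<phi>
    using sim[OF that] c by (intro injI) (metis dist_eq_0_iff mult_eq_0_iff order_less_irrefl)
  ultimately obtain A where A: "compact A" "A \<noteq> {}" "A = (\<Union>\<phi>\<in>\<Phi>. \<phi> ` A)" "A \<subseteq> X"
    using attractor_exists[OF fin _ _ X] by metis
  have "attractor \<Phi> = A"
    unfolding attractor_def
  proof (rule the_equality)
    fix B assume "compact B \<and> B \<noteq> {} \<and> B = (\<Union>\<phi>\<in>\<Phi>. \<phi> ` B)"
    then show "B = A"
      using A sim c by (intro attractor_unique[of c \<Phi> B A]) auto
  qed (use A in blast)
  with A show "compact (attractor \<Phi>)" "attractor \<Phi> \<noteq> {}"
    "attractor \<Phi> = (\<Union>\<phi>\<in>\<Phi>. \<phi> ` attractor \<Phi>)" "attractor \<Phi> \<subseteq> X" by auto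
qed


section \<open>Level cuts of the grid of remaining squares\<close>

text \<open>Indices of the squares that are kept, for even \<open>n\<close>: a closed square meets a
  midsegment iff one of its indices is \<open>n div 2 - 1\<close> or \<open>n div 2\<close>, and
  meets the sides of the unit square iff one of its indices is \<open>0\<close> or
  \<open>n - 1\<close>.\<close>

definition digits :: "nat \<Rightarrow> (nat \<times> nat) set" where
  "digits n = {(i, j). i < n \<and> j < n \<and>
     \<not> ((i \<in> {n div 2 - 1, n div 2} \<or> j \<in> {n div 2 - 1, n div 2}) \<and> i \<notin> {0, n - 1} \<and> j \<notin> {0, n - 1})}"

text \<open>In use \<open>g\<close> tells at each grid point whether the function is at most
  \<open>r\<close>. A mixed square, named by its lower left grid point, is then one that
  \<open>r\<close> crosses.\<close>

definition mixed :: "(nat \<times> nat \<Rightarrow> bool) \<Rightarrow> nat \<times> nat \<Rightarrow> bool" where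
  "mixed g = (\<lambda>(i, j). \<not> (g (Suc i, j) = g (i, j) \<and> g (i, Suc j) = g (i, j) \<and> g (Suc i, Suc j) = g (i, j)))"

definition corners_mixed :: "nat \<Rightarrow> (nat \<times> nat \<Rightarrow> bool) \<Rightarrow> bool" where
  "corners_mixed n g \<longleftrightarrow> \<not> (g (n, 0) = g (0, 0) \<and> g (0, n) = g (0, 0) \<and> g (n, n) = g (0, 0))"

text \<open>The two outer layers along each side. The squares found by \<open>mixed_strip\<close>
  lie there, and their number is linear in \<open>n\<close>, which the mass estimate
  \<open>sum_mass_bad_words\<close> depends on.\<close>

definition strip :: "nat \<Rightarrow> (nat \<times> nat) set" where
  "strip n = {(i, j) \<in> digits n. i \<le> 1 \<or> n - 2 \<le> i \<or> j \<le> 1 \<or> n - 2 \<le> j}"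

text \<open>Positions along a side that are within distance two of its ends or within distance one of the
  removed columns; elsewhere the neighbouring subsquares in the first two rows are all present.\<close>

definition critical :: "nat \<Rightarrow> nat set" where
  "critical n = {0, 1, 2, n - 3, n - 2, n - 1, n div 2 - 2, n div 2 - 1, n div 2, n div 2 + 1}"

definition bad :: "nat \<Rightarrow> (nat \<times> nat) set" where
  "bad n = critical n \<times> {0, n - 1} \<union> {0, n - 1} \<times> critical n"

section \<open>Counting bad squares and squares near the boundary\<close>

lemma critical_less: "8 \<le> n \<Longrightarrow> i \<in> critical n \<Longrightarrow> i < n"
  by (auto simp: critical_def)

lemma finite_digits: "finite (digits n)"
  by (rule finite_subset[of _ "{..<n} \<times> {..<n}"]) (auto simp: digits_def)

lemma strip_subset_digits: "strip n \<subseteq> digits n"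
  by (auto simp: strip_def)

lemma bad_subset_strip: "8 \<le> n \<Longrightarrow> bad n \<subseteq> strip n"
  using critical_less[of n] by (auto simp: bad_def strip_def digits_def)

lemma card_bad: "card (bad n) \<le> 40"
proof -
  have "card (critical n) \<le> 10"
    unfolding critical_def
    using card_length[of "[0, 1, 2, n - 3, n - 2, n - 1, n div 2 - 2, n div 2 - 1, n div 2, n div 2 + 1]"]
    by simp
  moreover have "card {0, n - 1} \<le> 2"
    using card_length[of "[0, n - 1]"] by simp
  ultimately have "card (critical n) * card {0, n - 1} \<le> 10 * 2"
    by (rule mult_mono) auto
  then have "card (critical n \<times> {0, n - 1}) + card ({0, n - 1} \<times> critical n) \<le> 40"
    by (simp only: card_cartesian_product mult.commute)
  then show ?thesis
    unfolding bad_def by (rule order.trans[OF card_Un_le])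
qed

lemma card_strip: "card (strip n) \<le> 8 * n"
proof -
  define S where "S = {0, 1, n - 2, n - 1}"
  have S: "a \<in> S" if "a < n" "a \<le> 1 \<or> n - 2 \<le> a" for a
  proof -
    have "a = 0 \<or> a = 1 \<or> a = n - 2 \<or> a = n - 1" using that by linarith
    then show ?thesis by (auto simp: S_def)
  qed
  have "strip n \<subseteq> S \<times> {..<n} \<union> {..<n} \<times> S"
    unfolding strip_def digits_def using S by blast
  then have "card (strip n) \<le> card (S \<times> {..<n} \<union> {..<n} \<times> S)"
    by (rule card_mono[rotated]) (simp add: S_def)
  also have "\<dots> \<le> card (S \<times> {..<n}) + card ({..<n} \<times> S)"
    by (rule card_Un_le)
  also have "\<dots> = 2 * (card S * n)"
    by (simp add: card_cartesian_product)
  also have "\<dots> \<le> 2 * (4 * n)"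
    using card_length[of "[0, 1, n - 2, n - 1]"] by (simp add: S_def)
  finally show ?thesis by simp
qed

text \<open>All squares of the outer frame are kept, so \<open>g\<close> is constant around the
  boundary. Any other kept square avoids the two middle rows and columns, and the part of its row
  between it and the nearer vertical side is kept, so the value is carried inwards along that
  row.\<close>

lemma digits_connected:
  assumes n: "8 \<le> n" and unmixed: "\<And>d. d \<in> digits n \<Longrightarrow> \<not> mixed g d" and d: "(i, j) \<in> digits n"
  shows "g (i, j) = g (0, 0)"
proof -
  have eq: "g (Suc a, b) = g (a, b)" "g (a, Suc b) = g (a, b)" "g (Suc a, Suc b) = g (a, b)"
    if "(a, b) \<in> digits n" for a b
    using unmixed[OF that] by (auto simp: mixed_def)
  have bot: "g (a, 0) = g (0, 0)" if "a \<le> n" for a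
    using that
  proof (induction a)
    case (Suc a)
    then show ?case using eq(1)[of a 0] by (auto simp: digits_def)
  qed simp
  have left: "g (0, b) = g (0, 0)" if "b \<le> n" for b
    using that
  proof (induction b)
    case (Suc b)
    then show ?case using eq(2)[of 0 b] by (auto simp: digits_def)
  qed simp
  have top: "g (a, n) = g (0, 0)" if "a \<le> n" for a
    using that
  proof (induction a)
    case (Suc a)
    then have "(a, n - 1) \<in> digits n" using n by (simp add: digits_def)
    from eq(2,3)[OF this] Suc n show ?case by simp
  qed (use left[of n] in simp)
  have right: "g (n, b) = g (0, 0)" if "b \<le> n" for b
    using that
  proof (induction b)
    case (Suc b)
    then have "(n - 1, b) \<in> digits n" using n by (simp add: digits_def)
    from eq(1,3)[OF this] Suc n show ?case by simp
  qed (use bot[of n] in simp)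
  show ?thesis
  proof (cases "j \<in> {n div 2 - 1, n div 2}")
    case True
    then have "i = 0 \<or> i = n - 1" using d n by (auto simp: digits_def)
    then show ?thesis
      using left[of j] right[of j] eq(1)[OF d] d n by (auto simp: digits_def)
  next
    case jm: False
    show ?thesis
    proof (cases "i \<in> {n div 2 - 1, n div 2}")
      case True
      then have "j = 0 \<or> j = n - 1" using d n by (auto simp: digits_def)
      then show ?thesis
        using bot[of i] top[of i] eq(2)[OF d] d n by (auto simp: digits_def)
    next
      case im: False
      have jn: "j < n" using d by (auto simp: digits_def)
      show ?thesis
      proof (cases "i < n div 2 - 1")
        case True
        have "a < n div 2 \<longrightarrow> g (a, j) = g (0, 0)" for a
        proof (induction a)
          case 0
          show ?case using left[of j] jn by simp
        next
          case (Suc a)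
          show ?case
          proof
            assume a: "Suc a < n div 2"
            then have "(a, j) \<in> digits n" using jm jn n by (auto simp: digits_def)
            from eq(1)[OF this] Suc a show "g (Suc a, j) = g (0, 0)" by auto
          qed
        qed
        then show ?thesis using True by simp
      next
        case False
        then have "n div 2 < i" using im by auto
        moreover have "i \<le> n" using d by (auto simp: digits_def)
        ultimately have "i \<le> n" "n div 2 < i" by auto
        from this show ?thesis
        proof (induction i rule: inc_induct)
          case base
          show ?case using right[of j] jn by simp
        next
          case (step a)
          have "(a, j) \<in> digits n" using step jm jn n by (auto simp: digits_def)
          from eq(1)[OF this] step show ?case by auto
        qed
      qed
    qed
  qed
qed

text \<open>Two mixed squares arise near the place where \<open>g\<close> changes along the side.
  The range \<open>2 \<le> i \<le> n - 3\<close> keeps the squares of different sides apart, and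
  excluding the middle columns for \<open>h = 1\<close> ensures that the squares exist among the
  \<open>digits\<close>.\<close>

lemma mixed_side:
  assumes n: "8 \<le> n" and ends: "g (n, 0) \<noteq> g (0, 0)"
    and crit: "\<And>i. i \<in> critical n \<Longrightarrow> \<not> mixed g (i, 0)"
  shows "\<exists>T. card T = 2 \<and> (\<forall>d\<in>T. mixed g d) \<and>
    T \<subseteq> {(i, h). 2 \<le> i \<and> i \<le> n - 3 \<and> h \<le> 1 \<and> (h = 0 \<or> i \<notin> {n div 2 - 1, n div 2})}"
proof -
  have "\<exists>i<n. g (Suc i, 0) \<noteq> g (i, 0)"
  proof (rule ccontr)
    assume *: "\<not> (\<exists>i<n. g (Suc i, 0) \<noteq> g (i, 0))"
    have "a \<le> n \<longrightarrow> g (a, 0) = g (0, 0)" for a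
    proof (induction a)
      case (Suc a)
      then show ?case using * by (metis Suc_le_eq Suc_leD)
    qed simp
    from this[of n] ends show False by simp
  qed
  then obtain i where i: "i < n" "g (Suc i, 0) \<noteq> g (i, 0)" by blast
  then have m: "mixed g (i, 0)" by (auto simp: mixed_def)
  with crit have "i \<notin> critical n" by blast
  then have ri: "3 \<le> i" "i \<le> n - 4" "i \<noteq> n div 2 - 1" "i \<noteq> n div 2"
  proof -
    have "i \<noteq> 0" "i \<noteq> 1" "i \<noteq> 2" "i \<noteq> n - 1" "i \<noteq> n - 2" "i \<noteq> n - 3"
      "i \<noteq> n div 2 - 1" "i \<noteq> n div 2"
      using \<open>i \<notin> critical n\<close> by (simp_all add: critical_def)
    then show "i \<noteq> n div 2 - 1" "i \<noteq> n div 2" by auto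
    show "3 \<le> i" using \<open>i \<noteq> 0\<close> \<open>i \<noteq> 1\<close> \<open>i \<noteq> 2\<close> by linarith
    show "i \<le> n - 4" using \<open>i \<noteq> n - 1\<close> \<open>i \<noteq> n - 2\<close> \<open>i \<noteq> n - 3\<close> i(1) n by linarith
  qed
  \<comment> \<open>Around the square \<open>(i, 0)\<close> a change along the bottom edge forces a
    change along another edge, and that edge is shared with the square above, to the left or to the
    right.\<close>
  have "mixed g (i - 1, 0) \<or> mixed g (i + 1, 0) \<or> mixed g (i, 1)"
  proof (cases "g (i, 1) = g (Suc i, 1)")
    case True
    then have "g (i, 1) \<noteq> g (i, 0) \<or> g (Suc i, 1) \<noteq> g (Suc i, 0)" using i(2) by auto
    moreover have "Suc (i - 1) = i" using ri by simp
    ultimately show ?thesis by (auto simp: mixed_def)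
  next
    case False
    then show ?thesis by (auto simp: mixed_def)
  qed
  then obtain d where d: "mixed g d" "d \<in> {(i - 1, 0), (i + 1, 0), (i, 1)}" by blast
  have "d \<noteq> (i, 0)" using d(2) ri by auto
  then have "card {(i, 0), d} = 2" by simp
  moreover have "{(i, 0), d} \<subseteq> {(i, h). 2 \<le> i \<and> i \<le> n - 3 \<and> h \<le> 1 \<and> (h = 0 \<or> i \<notin> {n div 2 - 1, n div 2})}"
    using d(2) ri by auto
  ultimately show ?thesis using m d(1) by (intro exI[of _ "{(i, 0), d}"]) auto
qed

text \<open>\<open>mixed_side\<close> is applied to all four sides by symmetry. If \<open>g\<close>
  is not constant on the corners it changes along at least two sides, and each of these contributes
  two mixed squares, disjoint from those of the other.\<close>

lemma mixed_strip:
  assumes n: "8 \<le> n" and g: "corners_mixed n g"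
  shows "(\<exists>d\<in>bad n. mixed g d) \<or> 4 \<le> card {d \<in> strip n. mixed g d}"
proof (cases "\<exists>d\<in>bad n. mixed g d")
  case False
  then have nb: "\<not> mixed g d" if "d \<in> bad n" for d using that by blast
  define M where "M = {d \<in> strip n. mixed g d}"
  have finM: "finite M"
    unfolding M_def using finite_subset[OF strip_subset_digits finite_digits] by simp
  define R :: "(nat \<times> nat) set" where "R = {(i, h). 2 \<le> i \<and> i \<le> n - 3 \<and> h \<le> 1 \<and> (h = 0 \<or> i \<notin> {n div 2 - 1, n div 2})}"
  \<comment> \<open>The symmetry needs two maps: \<open>\<sigma>\<close> moves grid points and
    \<open>\<tau>\<close> moves squares. A reflection sends the point coordinate \<open>h\<close> to
    \<open>n - h\<close> but the square index \<open>h\<close> to \<open>n - 1 - h\<close>.\<close>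
  have side: "\<exists>T\<subseteq>M \<inter> \<tau> ` R. card T = 2"
    if ends: "g (\<sigma> (n, 0)) \<noteq> g (\<sigma> (0, 0))"
      and mx: "\<And>i h. i < n \<Longrightarrow> h \<le> 1 \<Longrightarrow> mixed (g \<circ> \<sigma>) (i, h) = mixed g (\<tau> (i, h))"
      and inj: "inj_on \<tau> R" and R: "\<tau> ` R \<subseteq> strip n"
      and cr: "\<And>i. i \<in> critical n \<Longrightarrow> \<tau> (i, 0) \<in> bad n" for \<sigma> \<tau>
  proof -
    have "\<exists>T. card T = 2 \<and> (\<forall>d\<in>T. mixed (g \<circ> \<sigma>) d) \<and> T \<subseteq> R"
      unfolding R_def
    proof (rule mixed_side[OF n])
      show "(g \<circ> \<sigma>) (n, 0) \<noteq> (g \<circ> \<sigma>) (0, 0)" using ends by simp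
      show "\<not> mixed (g \<circ> \<sigma>) (i, 0)" if "i \<in> critical n" for i
        using mx[of i 0] nb[OF cr[OF that]] critical_less[OF n that] by simp
    qed
    then obtain T where T: "card T = 2" "\<forall>d\<in>T. mixed (g \<circ> \<sigma>) d" "T \<subseteq> R"
      by (elim exE conjE) (rule that)
    have *: "mixed g (\<tau> d)" if dT: "d \<in> T" for d
    proof -
      have "d \<in> R" using T(3) dT by blast
      then obtain i h where "d = (i, h)" "i < n" "h \<le> 1" using n unfolding R_def by (cases d) auto
      then show ?thesis using mx[of i h] T(2) dT by simp
    qed
    have "\<tau> ` T \<subseteq> M \<inter> \<tau> ` R" using * T(3) R unfolding M_def by blast
    moreover have "card (\<tau> ` T) = 2"
      using card_image[OF inj_on_subset[OF inj T(3)]] T(1) by simp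
    ultimately show ?thesis by blast
  qed
  define B where "B = (\<lambda>d::nat \<times> nat. d) ` R"
  define U where "U = (\<lambda>(i, h). (i, n - 1 - h)) ` R"
  define L where "L = (\<lambda>(i, h). (h, i)) ` R"
  define W where "W = (\<lambda>(i, h). (n - 1 - h, i)) ` R"
  have RD: "(i, h) \<in> strip n \<and> (i, n - 1 - h) \<in> strip n \<and> (h, i) \<in> strip n \<and> (n - 1 - h, i) \<in> strip n"
    if "(i, h) \<in> R" for i h
  proof -
    have R: "i < n" "h < n" "h \<le> 1" "n - 1 - h < n" "n - 2 \<le> n - 1 - h"
      "h = 0 \<or> i \<notin> {n div 2 - 1, n div 2}"
      using that n by (auto simp: R_def)
    have h: "h \<notin> {n div 2 - 1, n div 2}" "n - 1 - h \<notin> {n div 2 - 1, n div 2}"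
      using \<open>h \<le> 1\<close> n by auto
    have h0: "h = 0 \<Longrightarrow> n - 1 - h = n - 1" by simp
    show ?thesis
      unfolding strip_def digits_def using R h h0 by blast
  qed
  have Rn: "i < n" "h < n" if "(i, h) \<in> R" for i h
    using that n by (auto simp: R_def)
  have refl: "n - h = Suc (n - Suc h)" if "h \<le> 1" for h
    using n that by auto
  have canc: "h = h'" if "n - Suc h = n - Suc h'" "h < n" "h' < n" for h h'
    using that by linarith
  have sB: "\<exists>T\<subseteq>M \<inter> B. card T = 2" if "g (n, 0) \<noteq> g (0, 0)"
    unfolding B_def
  proof (rule side[of "\<lambda>d. d" "\<lambda>d. d"])
    show "(\<lambda>d. d) ` R \<subseteq> strip n" using RD by auto
  qed (use that in \<open>auto simp: comp_def bad_def\<close>)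
  have sU: "\<exists>T\<subseteq>M \<inter> U. card T = 2" if "g (n, n) \<noteq> g (0, n)"
    unfolding U_def
  proof (rule side[of "\<lambda>(i, h). (i, n - h)" "\<lambda>(i, h). (i, n - 1 - h)"])
    show "mixed (g \<circ> (\<lambda>(i, h). (i, n - h))) (i, h) = mixed g ((\<lambda>(i, h). (i, n - 1 - h)) (i, h))"
      if "h \<le> 1" for i h
      unfolding mixed_def comp_def prod.case by (simp add: refl[OF that]) blast
    show "(\<lambda>(i, h). (i, n - 1 - h)) ` R \<subseteq> strip n" using RD by auto
    show "inj_on (\<lambda>(i, h). (i, n - 1 - h)) R" by (rule inj_onI) (auto intro!: canc dest: Rn(2))
  qed (use that in \<open>auto simp: bad_def\<close>)
  have sL: "\<exists>T\<subseteq>M \<inter> L. card T = 2" if "g (0, n) \<noteq> g (0, 0)"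
    unfolding L_def
  proof (rule side[of "\<lambda>(i, h). (h, i)" "\<lambda>(i, h). (h, i)"])
    show "mixed (g \<circ> (\<lambda>(i, h). (h, i))) (i, h) = mixed g ((\<lambda>(i, h). (h, i)) (i, h))" for i h
      unfolding mixed_def comp_def prod.case by blast
    show "(\<lambda>(i, h). (h, i)) ` R \<subseteq> strip n" using RD by auto
  qed (use that in \<open>auto simp: bad_def inj_on_def\<close>)
  have sW: "\<exists>T\<subseteq>M \<inter> W. card T = 2" if "g (n, n) \<noteq> g (n, 0)"
    unfolding W_def
  proof (rule side[of "\<lambda>(i, h). (n - h, i)" "\<lambda>(i, h). (n - 1 - h, i)"])
    show "mixed (g \<circ> (\<lambda>(i, h). (n - h, i))) (i, h) = mixed g ((\<lambda>(i, h). (n - 1 - h, i)) (i, h))"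
      if "h \<le> 1" for i h
      unfolding mixed_def comp_def prod.case by (simp add: refl[OF that]) blast
    show "(\<lambda>(i, h). (n - 1 - h, i)) ` R \<subseteq> strip n" using RD by auto
    show "inj_on (\<lambda>(i, h). (n - 1 - h, i)) R" by (rule inj_onI) (auto intro!: canc dest: Rn(2))
  qed (use that in \<open>auto simp: bad_def\<close>)
  have loc: "d \<in> B \<Longrightarrow> 2 \<le> fst d \<and> fst d \<le> n - 3 \<and> snd d \<le> 1"
    "d \<in> U \<Longrightarrow> 2 \<le> fst d \<and> fst d \<le> n - 3 \<and> n - 2 \<le> snd d"
    "d \<in> L \<Longrightarrow> 2 \<le> snd d \<and> snd d \<le> n - 3 \<and> fst d \<le> 1"
    "d \<in> W \<Longrightarrow> 2 \<le> snd d \<and> snd d \<le> n - 3 \<and> n - 2 \<le> fst d" for d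
    unfolding B_def U_def L_def W_def R_def using n by auto
  have disjI: "X \<inter> Y = {}" if "\<And>d. d \<in> X \<Longrightarrow> d \<in> Y \<Longrightarrow> False" for X Y :: "(nat \<times> nat) set"
    using that by blast
  have nn: "\<not> n - 2 \<le> 1" "\<not> n - 2 \<le> n - 3" using n by auto
  have disj: "B \<inter> U = {}" "B \<inter> L = {}" "B \<inter> W = {}" "U \<inter> L = {}" "U \<inter> W = {}" "L \<inter> W = {}"
    by (intro disjI; drule loc; drule loc; use nn in \<open>elim conjE, linarith\<close>)+
  have pair: "4 \<le> card M"
    if "\<exists>T\<subseteq>M \<inter> X. card T = 2" "\<exists>T\<subseteq>M \<inter> Y. card T = 2" "X \<inter> Y = {}" for X Y
  proof -
    from that obtain S T where ST: "S \<subseteq> M \<inter> X" "card S = 2" "T \<subseteq> M \<inter> Y" "card T = 2" by blast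
    then have "finite S" "finite T" "S \<inter> T = {}"
      using finM that(3) by (auto intro: finite_subset)
    then have "card (S \<union> T) = 4" using ST by (simp add: card_Un_disjoint)
    moreover have "card (S \<union> T) \<le> card M" using ST finM by (intro card_mono) auto
    ultimately show ?thesis by simp
  qed
  \<comment> \<open>Around the cycle of four corners a boolean function changes an even number of
    times, so a nonconstant one changes at least twice. The six disjuncts are the pairs of
    sides.\<close>
  have "g (n, 0) \<noteq> g (0, 0) \<and> g (n, n) \<noteq> g (0, n) \<or> g (n, 0) \<noteq> g (0, 0) \<and> g (0, n) \<noteq> g (0, 0) \<or>
      g (n, 0) \<noteq> g (0, 0) \<and> g (n, n) \<noteq> g (n, 0) \<or> g (n, n) \<noteq> g (0, n) \<and> g (0, n) \<noteq> g (0, 0) \<or>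
      g (n, n) \<noteq> g (0, n) \<and> g (n, n) \<noteq> g (n, 0) \<or> g (0, n) \<noteq> g (0, 0) \<and> g (n, n) \<noteq> g (n, 0)"
    using g unfolding corners_mixed_def by blast
  then have "4 \<le> card M"
    using pair[OF sB sU disj(1)] pair[OF sB sL disj(2)] pair[OF sB sW disj(3)]
        pair[OF sU sL disj(4)] pair[OF sU sW disj(5)] pair[OF sL sW disj(6)] by blast
  then show ?thesis unfolding M_def by simp
qed auto


section \<open>The geometry of \<open>\<boxplus>(m)\<close>\<close>

definition place :: "nat \<Rightarrow> nat \<times> nat \<Rightarrow> real \<times> real \<Rightarrow> real \<times> real" where
  "place n d z = ((fst z + real (fst d)) / real n, (snd z + real (snd d)) / real n)"

lemma place_eq: "place n (i, j) = (\<lambda>z. (1 / real n) *\<^sub>R z + (real i / real n, real j / real n))"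
  by (auto simp: place_def fun_eq_iff add_divide_distrib)

lemma dist_place: "0 < n \<Longrightarrow> dist (place n d x) (place n d y) = dist x y / real n"
  by (cases d) (simp add: place_eq dist_norm flip: scaleR_diff_right)

lemma image_unit_square:
  assumes "0 < c"
  shows "(\<lambda>z. c *\<^sub>R z + v) ` unit_square = {fst v..fst v + c} \<times> {snd v..snd v + c}"
proof -
  have "(\<lambda>z. c *\<^sub>R z + v) = (\<lambda>(x, y). (c * x + fst v, c * y + snd v))"
    by (cases v) auto
  then have "(\<lambda>z. c *\<^sub>R z + v) ` unit_square =
      ((\<lambda>t. c * t + fst v) ` {0..1}) \<times> ((\<lambda>t. c * t + snd v) ` {0..1})"
    unfolding unit_square_def by (simp only: image_paired_Times)
  moreover have "(\<lambda>t. c * t + s) ` {0..1} = {s..s + c}" for s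
    using image_affinity_atLeastAtMost[of c s 0 1] assms by (simp add: add.commute)
  ultimately show ?thesis by simp
qed

lemma frontier_rectangle:
  fixes a b c d :: real
  shows "frontier ({a..b} \<times> {c..d}) = {a..b} \<times> {c..d} - {a<..<b} \<times> {c<..<d}"
  by (simp add: frontier_def closure_Times interior_Times)

text \<open>As \<open>n\<close> is even, \<open>1/2\<close> is a grid coordinate. Hence a tile that
  meets a midsegment has a corner on it, and a tile that meets a side of the unit square has a
  corner there; corners lie on the frontier. This replaces the conditions on frontiers by conditions
  on indices.\<close>

lemma tile_in_remaining_tiles_iff:
  assumes m: "3 \<le> m" and ij: "i < 2 ^ m" "j < 2 ^ m"
  shows "tile m i j \<in> remaining_tiles m \<longleftrightarrow> (i, j) \<in> digits (2 ^ m)"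
proof -
  define h :: nat where "h = 2 ^ (m - 1)"
  define n :: nat where "n = 2 ^ m"
  have "m = Suc (m - 1)" using m by simp
  then have nh: "n = 2 * h" unfolding n_def h_def by (metis power_Suc)
  have h2: "2 \<le> h" using m power_increasing[of 1 "m - 1" "2::nat"] by (simp add: h_def)
  have rn: "(2::real) ^ m = real n" by (simp add: n_def)
  have rn0: "0 < real n" using h2 nh by simp
  have dn: "n div 2 = h" using nh by simp
  have tile: "tile m i j = {real i / n..real (Suc i) / n} \<times> {real j / n..real (Suc j) / n}"
    by (simp add: tile_def rn)
  have fr: "frontier (tile m i j) = tile m i j -
      {real i / n<..<real (Suc i) / n} \<times> {real j / n<..<real (Suc j) / n}"
    unfolding tile by (rule frontier_rectangle)
  have fs: "frontier unit_square = unit_square - {0<..<1} \<times> {0<..<1}"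
    unfolding unit_square_def by (rule frontier_rectangle)
  have in0: "real i / n \<in> {0..1}" "real (Suc i) / n \<in> {0..1}" "real j / n \<in> {0..1}" "real (Suc j) / n \<in> {0..1}"
    using ij rn0 by (auto simp: n_def[symmetric] Suc_le_eq)
  have corner: "(s, t) \<in> frontier (tile m i j)"
    if "s \<in> {real i / n, real (Suc i) / n}" "t \<in> {real j / n, real (Suc j) / n}" for s t
    using that rn0 by (subst fr) (auto simp: tile divide_right_mono)
  have edge: "frontier (tile m i j) \<inter> frontier unit_square \<noteq> {}" if "i \<in> {0, n - 1} \<or> j \<in> {0, n - 1}"
  proof -
    have ends: "\<exists>s. s \<in> {real a / n, real (Suc a) / n} \<and> s \<in> {0, 1}" if "a \<in> {0, n - 1}" for a
    proof (cases "a = 0")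
      case False
      then have "Suc a = n" using that rn0 by auto
      then show ?thesis using rn0 by (intro exI[of _ 1]) simp
    qed auto
    have "\<exists>s t. s \<in> {real i / n, real (Suc i) / n} \<and> t \<in> {real j / n, real (Suc j) / n}
        \<and> (s \<in> {0, 1} \<or> t \<in> {0, 1})"
      using that ends[of i] ends[of j] by blast
    then obtain s t where st: "s \<in> {real i / n, real (Suc i) / n}" "t \<in> {real j / n, real (Suc j) / n}"
      "s \<in> {0, 1} \<or> t \<in> {0, 1}" by blast
    have "s \<in> {0..1}" "t \<in> {0..1}" using st(1,2) in0 by auto
    then have "(s, t) \<in> frontier unit_square"
      using st(3) by (subst fs) (auto simp: unit_square_def)
    with corner[OF st(1,2)] show ?thesis by blast
  qed
  have inner: "frontier (tile m i j) \<inter> frontier unit_square = {}"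
    if "i \<notin> {0, n - 1}" "j \<notin> {0, n - 1}"
  proof -
    have "0 < i" "0 < j" "Suc i < n" "Suc j < n" using that ij by (auto simp: n_def)
    then have "0 < real i / n" "real (Suc i) / n < 1" "0 < real j / n" "real (Suc j) / n < 1"
      using rn0 by (auto simp: divide_simps)
    then have "tile m i j \<subseteq> {0<..<1} \<times> {0<..<1}"
      unfolding tile by (auto intro: less_le_trans le_less_trans)
    then show ?thesis unfolding fr fs by blast
  qed
  have half: "a = h - 1 \<or> a = h" if "real a / n \<le> 1/2" "1/2 \<le> real (Suc a) / n" for a
  proof -
    have "real a \<le> real h" "real h \<le> real (Suc a)"
      using that rn0 nh by (auto simp: divide_simps)
    then show ?thesis by auto
  qed
  have half': "1/2 \<in> {real a / n, real (Suc a) / n}" if "a = h - 1 \<or> a = h" for a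
    using that h2 nh by (auto simp: of_nat_diff)
  have mid: "frontier (tile m i j) \<inter> midsegments \<noteq> {}" if "i \<in> {h - 1, h} \<or> j \<in> {h - 1, h}"
    using that
  proof
    assume "i \<in> {h - 1, h}"
    then have "(1/2, real j / n) \<in> frontier (tile m i j)" by (intro corner half') auto
    moreover have "(1/2, real j / n) \<in> midsegments" using in0 by (auto simp: midsegments_def)
    ultimately show ?thesis by blast
  next
    assume "j \<in> {h - 1, h}"
    then have "(real i / n, 1/2) \<in> frontier (tile m i j)" by (intro corner half') auto
    moreover have "(real i / n, 1/2) \<in> midsegments" using in0 by (auto simp: midsegments_def)
    ultimately show ?thesis by blast
  qed
  have nomid: "frontier (tile m i j) \<inter> midsegments = {}" if "i \<notin> {h - 1, h}" "j \<notin> {h - 1, h}"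
  proof -
    have "p \<notin> midsegments" if "p \<in> tile m i j" for p
      using that half[of i] half[of j] \<open>i \<notin> {h - 1, h}\<close> \<open>j \<notin> {h - 1, h}\<close>
      unfolding tile midsegments_def by auto
    then show ?thesis unfolding fr by blast
  qed
  have "tile m i j \<in> tiling m" using ij by (auto simp: tiling_def)
  then show ?thesis
    unfolding remaining_tiles_def digits_def n_def[symmetric] dn
    using edge inner mid nomid ij unfolding n_def[symmetric] by blast
qed

lemma boxplus_ifs_eq:
  assumes m: "3 \<le> m"
  shows "boxplus_ifs m = place (2 ^ m) ` digits (2 ^ m)"
proof (intro equalityI subsetI)
  fix \<phi> assume "\<phi> \<in> boxplus_ifs m"
  then obtain v where v: "\<phi> = (\<lambda>z. (1 / 2 ^ m) *\<^sub>R z + v)" "\<phi> ` unit_square \<in> remaining_tiles m"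
    by (auto simp: boxplus_ifs_def)
  then obtain i j where ij: "\<phi> ` unit_square = tile m i j" "i < 2 ^ m" "j < 2 ^ m"
    by (auto simp: remaining_tiles_def tiling_def)
  have "{fst v..fst v + 1 / 2 ^ m} \<times> {snd v..snd v + 1 / 2 ^ m} = tile m i j"
    using ij(1) unfolding v(1) by (subst (asm) image_unit_square) auto
  then have "fst v = real i / 2 ^ m" "snd v = real j / 2 ^ m"
    unfolding tile_def by (auto simp: times_eq_iff Icc_eq_Icc)
  then have "\<phi> = place (2 ^ m) (i, j)"
    unfolding v(1) place_eq by (cases v) simp
  moreover have "(i, j) \<in> digits (2 ^ m)"
    using tile_in_remaining_tiles_iff[OF m ij(2,3)] v(2) ij(1) by simp
  ultimately show "\<phi> \<in> place (2 ^ m) ` digits (2 ^ m)" by blast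
next
  fix \<phi> assume "\<phi> \<in> place (2 ^ m) ` digits (2 ^ m)"
  then obtain i j where ij: "\<phi> = place (2 ^ m) (i, j)" "(i, j) \<in> digits (2 ^ m)" by auto
  have lt: "i < 2 ^ m" "j < 2 ^ m" using ij(2) by (auto simp: digits_def)
  have \<phi>: "\<phi> = (\<lambda>z. (1 / 2 ^ m) *\<^sub>R z + (real i / 2 ^ m, real j / 2 ^ m))"
    unfolding ij(1) place_eq by simp
  have "\<phi> ` unit_square = tile m i j"
    unfolding \<phi> by (subst image_unit_square) (auto simp: tile_def add_divide_distrib add.commute)
  then have "\<phi> ` unit_square \<in> remaining_tiles m"
    using tile_in_remaining_tiles_iff[OF m lt] ij(2) by simp
  with \<phi> show "\<phi> \<in> boxplus_ifs m" unfolding boxplus_ifs_def by blast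
qed

section \<open>Self-similar sets generated by the remaining squares\<close>

locale grid_fractal =
  fixes n :: nat and F :: "(real \<times> real) set"
  assumes n8: "8 \<le> n"
    and compact_F: "compact F" and F_nonempty: "F \<noteq> {}"
    and F_subset: "F \<subseteq> unit_square"
    and F_eq: "F = (\<Union>d\<in>digits n. place n d ` F)"

lemma place_unit_square:
  assumes "d \<in> digits n"
  shows "place n d ` unit_square \<subseteq> unit_square"
proof -
  have "Suc (fst d) \<le> n" "Suc (snd d) \<le> n" "0 < real n" using assms by (auto simp: digits_def)
  then have "real (fst d) + 1 \<le> real n" "real (snd d) + 1 \<le> real n" "0 < real n" by linarith+
  then show ?thesis
    by (auto simp: unit_square_def place_def divide_simps)
qed

lemma grid_fractal_boxplus:
  assumes m: "3 \<le> m"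
  shows "grid_fractal (2 ^ m) (boxplus m)"
proof -
  have n8: "8 \<le> (2 ^ m :: nat)" using power_increasing[OF m, of "2::nat"] by simp
  then have n1: "1 < real (2 ^ m)" by linarith
  have F: "boxplus m = attractor (place (2 ^ m) ` digits (2 ^ m))"
    unfolding boxplus_def boxplus_ifs_eq[OF m] ..
  have "(0, 0) \<in> digits (2 ^ m)" using n8 by (auto simp: digits_def)
  then have ne: "place (2 ^ m) ` digits (2 ^ m) \<noteq> {}" by blast
  have cs: "compact unit_square" "unit_square \<noteq> {}"
    unfolding unit_square_def by (auto intro: compact_Times)
  have sim: "dist (\<phi> x) (\<phi> y) = 1 / real (2 ^ m) * dist x y"
    if "\<phi> \<in> place (2 ^ m) ` digits (2 ^ m)" for \<phi> x y
    using that by (auto simp: dist_place)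
  have sub: "\<phi> ` unit_square \<subseteq> unit_square" if "\<phi> \<in> place (2 ^ m) ` digits (2 ^ m)" for \<phi>
    using that place_unit_square by blast
  have c: "0 < 1 / real (2 ^ m)" "1 / real (2 ^ m) < 1" using n1 by auto
  note A = attractor_properties[OF finite_imageI[OF finite_digits] ne c sim cs sub]
  show ?thesis
  proof
    show "boxplus m = (\<Union>d\<in>digits (2 ^ m). place (2 ^ m) d ` boxplus m)"
      using A(3) unfolding F[symmetric] by simp
  qed (use A n8 in \<open>simp_all add: F\<close>)
qed

context grid_fractal
begin

lemma n_pos: "0 < n" "0 < real n" "1 < real n"
  using n8 by auto

lemma place_F: "d \<in> digits n \<Longrightarrow> x \<in> F \<Longrightarrow> place n d x \<in> F"
  using F_eq by blast

text \<open>The map keeps \<open>F\<close> inside itself and contracts towards \<open>p\<close>.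
  Applied to the point of \<open>F\<close> nearest to \<open>p\<close>, it would give a nearer one
  unless the distance is 0.\<close>

lemma fixed_point_in_F:
  assumes d: "d \<in> digits n" and p: "place n d p = p"
  shows "p \<in> F"
proof -
  obtain a where a: "a \<in> F" "\<And>b. b \<in> F \<Longrightarrow> dist p a \<le> dist p b"
    using distance_attains_inf[of F p] compact_F F_nonempty compact_imp_closed by metis
  have "dist p a \<le> dist p (place n d a)" using a(2) place_F[OF d a(1)] .
  also have "\<dots> = dist p a / n"
    using dist_place[OF n_pos(1), of d p a] p by simp
  finally have "dist p a * n \<le> dist p a * 1" using n_pos by (simp add: field_simps)
  then have "\<not> 0 < dist p a" using n_pos(3) by (metis mult_le_cancel_left_pos not_le)
  then show ?thesis using a(1) by simp
qed

lemma corners_in_F: "{0, 1} \<times> {0, 1} \<subseteq> F"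
proof -
  have "real (n - Suc 0) = real n - 1" using n_pos by (simp add: of_nat_diff)
  note simps = this place_def digits_def
  have "(0, 0) \<in> F"
    by (rule fixed_point_in_F[of "(0, 0)"]) (use n_pos in \<open>auto simp: simps\<close>)
  moreover have "(0, 1) \<in> F"
    by (rule fixed_point_in_F[of "(0, n - 1)"]) (use n_pos in \<open>auto simp: simps\<close>)
  moreover have "(1, 0) \<in> F"
    by (rule fixed_point_in_F[of "(n - 1, 0)"]) (use n_pos in \<open>auto simp: simps\<close>)
  moreover have "(1, 1) \<in> F"
    by (rule fixed_point_in_F[of "(n - 1, n - 1)"]) (use n_pos in \<open>auto simp: simps\<close>)
  ultimately show ?thesis by auto
qed

end


section \<open>Crossed paths of squares\<close>

text \<open>One inequality is weak and the other strict, so that \<open>r\<close> crosses exactly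
  when the predicate \<open>h \<le> r\<close> is not constant on the corners. The combinatorial
  lemmas then apply to every real \<open>r\<close>.\<close>

definition crossed :: "(real \<times> real \<Rightarrow> real) \<Rightarrow> real \<Rightarrow> bool" where
  "crossed h r \<longleftrightarrow> (\<exists>a\<in>{0, 1} \<times> {0, 1}. \<exists>b\<in>{0, 1} \<times> {0, 1}. h a \<le> r \<and> r < h b)"

primrec address :: "nat \<Rightarrow> (nat \<times> nat) list \<Rightarrow> real \<times> real \<Rightarrow> real \<times> real" where
  "address n [] = (\<lambda>z. z)"
| "address n (d # w) = (\<lambda>z. place n d (address n w z))"

text \<open>Nested squares that are crossed at every level, with all letters in the strip. The
  function is pulled back to the unit square at each step, so that one statement about the whole
  square serves all levels.\<close>

primrec crossed_path :: "nat \<Rightarrow> (nat \<times> nat) list \<Rightarrow> (real \<times> real \<Rightarrow> real) \<Rightarrow> real \<Rightarrow> bool" where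
  "crossed_path n [] h r = crossed h r"
| "crossed_path n (d # w) h r =
     (crossed h r \<and> d \<in> strip n \<and> crossed_path n w (\<lambda>z. h (place n d z)) r)"

definition weight :: "nat \<Rightarrow> nat \<times> nat \<Rightarrow> real" where
  "weight n d = (if d \<in> bad n then 1 else 1/4)"

definition mass :: "nat \<Rightarrow> (nat \<times> nat) list \<Rightarrow> real" where
  "mass n w = prod_list (map (weight n) w)"

text \<open>Positional value with the most significant digit first. Applied to one coordinate of a
  word, it is the integer position of the square in the grid of its level, see
  \<open>address_eq\<close>.\<close>

primrec base_val :: "nat \<Rightarrow> nat list \<Rightarrow> nat" where
  "base_val n [] = 0"
| "base_val n (a # as) = a * n ^ length as + base_val n as"

lemma weight_pos: "0 < weight n d"
  by (simp add: weight_def)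

lemma mass_Nil [simp]: "mass n [] = 1"
  and mass_Cons [simp]: "mass n (d # w) = weight n d * mass n w"
  by (simp_all add: mass_def)

lemma mass_nonneg: "0 \<le> mass n w"
  by (induction w) (auto intro: mult_nonneg_nonneg less_imp_le weight_pos)

lemma address_append: "address n (v @ w) z = address n v (address n w z)"
  by (induction v) auto

lemma crossed_path_imp_crossed: "crossed_path n w h r \<Longrightarrow> crossed (\<lambda>z. h (address n w z)) r"
  by (induction w arbitrary: h) auto

lemma crossed_path_imp_strip: "crossed_path n w h r \<Longrightarrow> set w \<subseteq> strip n"
  by (induction w arbitrary: h) auto

lemma crossed_path_imp_root: "crossed_path n w h r \<Longrightarrow> crossed h r"
  by (cases w) auto

lemma crossed_path_append1: "crossed_path n (v @ w) h r \<Longrightarrow> crossed_path n v h r"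
  by (induction v arbitrary: h) (auto dest: crossed_path_imp_root)

lemma base_val_less:
  assumes "set as \<subseteq> {..<n}"
  shows "base_val n as < n ^ length as"
  using assms
proof (induction as)
  case (Cons a as)
  then have "Suc a * n ^ length as \<le> n * n ^ length as" by (intro mult_right_mono) auto
  with Cons show ?case by simp
qed simp

lemma base_val_inject:
  assumes "length as = length bs" "set as \<subseteq> {..<n}" "set bs \<subseteq> {..<n}" "base_val n as = base_val n bs"
  shows "as = bs"
  using assms
proof (induction as bs rule: list_induct2)
  case (Cons a as b bs)
  have lt: "base_val n as < n ^ length as" "base_val n bs < n ^ length as"
    using base_val_less[of as n] base_val_less[of bs n] Cons by auto
  have eq: "a * n ^ length as + base_val n as = b * n ^ length as + base_val n bs"
    using Cons by simp
  have div: "(c * N + v) div N = c" if "v < N" for c v N :: nat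
    using that by simp
  have "a = (a * n ^ length as + base_val n as) div n ^ length as"
    by (rule div[OF lt(1), symmetric])
  also have "\<dots> = b"
    unfolding eq by (rule div[OF lt(2)])
  finally have "a = b" .
  then show ?case using eq Cons by simp
qed simp

lemma crossed_iff_not_constant:
  "crossed h r \<longleftrightarrow> \<not> ((h (1, 0) \<le> r) = (h (0, 0) \<le> r) \<and> (h (0, 1) \<le> r) = (h (0, 0) \<le> r)
      \<and> (h (1, 1) \<le> r) = (h (0, 0) \<le> r))"
  unfolding crossed_def by (auto simp: not_le)

lemma crossed_iff_corners_mixed:
  assumes "0 < n"
  shows "crossed h r \<longleftrightarrow> corners_mixed n (\<lambda>p. h (real (fst p) / n, real (snd p) / n) \<le> r)"
  using assms unfolding crossed_iff_not_constant corners_mixed_def by simp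

lemma crossed_place_iff_mixed:
  "crossed (\<lambda>z. h (place n d z)) r \<longleftrightarrow> mixed (\<lambda>p. h (real (fst p) / n, real (snd p) / n) \<le> r) d"
  by (cases d) (simp add: crossed_iff_not_constant mixed_def place_def)

section \<open>Conservation of mass along crossed paths\<close>

context grid_fractal
begin

lemma finite_strip: "finite (strip n)"
  using finite_subset[OF strip_subset_digits finite_digits] .

text \<open>A bad subsquare suffices with its weight 1; otherwise there are four subsquares of
  weight at least 1/4.\<close>

lemma sum_weight_crossed:
  assumes "crossed h r"
  shows "1 \<le> (\<Sum>d | d \<in> strip n \<and> crossed (\<lambda>z. h (place n d z)) r. weight n d)"
proof -
  define M where "M = {d \<in> strip n. crossed (\<lambda>z. h (place n d z)) r}"
  have fin: "finite M" unfolding M_def using finite_strip by simp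
  define g where "g = (\<lambda>p. h (real (fst p) / n, real (snd p) / n) \<le> r)"
  have M: "M = {d \<in> strip n. mixed g d}"
    unfolding M_def g_def crossed_place_iff_mixed ..
  have "corners_mixed n g"
    using assms unfolding g_def crossed_iff_corners_mixed[OF n_pos(1)] .
  then have "(\<exists>d\<in>bad n. mixed g d) \<or> 4 \<le> card M"
    unfolding M by (rule mixed_strip[OF n8])
  then have "(\<exists>d\<in>bad n. d \<in> M) \<or> 4 \<le> card M"
    unfolding M using bad_subset_strip[OF n8] by blast
  then have "1 \<le> (\<Sum>d\<in>M. weight n d)"
  proof
    assume "\<exists>d\<in>bad n. d \<in> M"
    then obtain d where d: "d \<in> bad n" "d \<in> M" by blast
    then have "weight n d \<le> (\<Sum>d\<in>M. weight n d)"
      using fin by (intro member_le_sum) (auto intro: less_imp_le weight_pos)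
    then show ?thesis using d by (simp add: weight_def)
  next
    assume "4 \<le> card M"
    then have "1 \<le> real (card M) * (1/4)" by simp
    also have "\<dots> = (\<Sum>d\<in>M. 1/4)" by simp
    also have "\<dots> \<le> (\<Sum>d\<in>M. weight n d)" by (rule sum_mono) (simp add: weight_def)
    finally show ?thesis .
  qed
  then show ?thesis unfolding M_def by simp
qed

text \<open>A cut-set version of the mass argument that avoids constructing a measure: as mass does
  not decrease from a crossed square to its crossed subsquares, the words at which all long crossed
  paths are cut carry at least the mass 1 of the root. The words of \<open>S\<close> may have
  different lengths, and nested words only increase the sum.\<close>

lemma mass_of_cover:
  assumes "finite S" "crossed h r"
    and "\<And>w. length w = K \<Longrightarrow> crossed_path n w h r \<Longrightarrow> \<exists>v\<in>S. \<exists>u. w = v @ u"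
  shows "1 \<le> (\<Sum>v | v \<in> S \<and> crossed_path n v h r. mass n v)"
  using assms
proof (induction K arbitrary: h S)
  case 0
  then have "[] \<in> S" using "0.prems"(3)[of "[]"] by auto
  then have "mass n [] \<le> (\<Sum>v | v \<in> S \<and> crossed_path n v h r. mass n v)"
    using 0 by (intro member_le_sum) (auto intro: mass_nonneg)
  then show ?case by simp
next
  case (Suc K)
  show ?case
  proof (cases "[] \<in> S")
    case True
    then have "mass n [] \<le> (\<Sum>v | v \<in> S \<and> crossed_path n v h r. mass n v)"
      using Suc.prems by (intro member_le_sum) (auto intro: mass_nonneg)
    then show ?thesis by simp
  next
    case False
    define M where "M = {d \<in> strip n. crossed (\<lambda>z. h (place n d z)) r}"
    \<comment> \<open>The tails of the cutting words that begin with \<open>d\<close>. They cut the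
      crossed paths of the pulled back function, so the induction hypothesis applies to
      them.\<close>
    define T where "T d = {v. d # v \<in> S \<and> crossed_path n v (\<lambda>z. h (place n d z)) r}" for d
    have fin: "finite M" unfolding M_def using finite_strip by simp
    have finS: "finite {v. d # v \<in> S}" for d
      using finite_vimageI[OF Suc.prems(1), of "(#) d"] by (simp add: vimage_def)
    then have finT: "finite (T d)" for d unfolding T_def by simp
    have one: "1 \<le> (\<Sum>v\<in>T d. mass n v)" if d: "d \<in> M" for d
    proof -
      have "1 \<le> (\<Sum>v | v \<in> {v. d # v \<in> S} \<and> crossed_path n v (\<lambda>z. h (place n d z)) r. mass n v)"
      proof (rule Suc.IH[OF finS])
        show "crossed (\<lambda>z. h (place n d z)) r" using d by (simp add: M_def)
        fix w assume w: "length w = K" "crossed_path n w (\<lambda>z. h (place n d z)) r"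
        have "length (d # w) = Suc K" "crossed_path n (d # w) h r"
          using w d Suc.prems(2) by (auto simp: M_def)
        then obtain v u where v: "v \<in> S" "d # w = v @ u" using Suc.prems(3) by blast
        then obtain v' where "v = d # v'" "w = v' @ u"
          using False by (cases v) auto
        then show "\<exists>v\<in>{v. d # v \<in> S}. \<exists>u. w = v @ u" using v(1) by auto
      qed
      then show ?thesis by (simp add: T_def)
    qed
    have "1 \<le> (\<Sum>d\<in>M. weight n d)"
      using sum_weight_crossed[OF Suc.prems(2)] unfolding M_def .
    also have "\<dots> \<le> (\<Sum>d\<in>M. weight n d * (\<Sum>v\<in>T d. mass n v))"
    proof (rule sum_mono)
      fix d assume "d \<in> M"
      from mult_left_mono[OF one[OF this] less_imp_le[OF weight_pos[of n d]]]
      show "weight n d \<le> weight n d * (\<Sum>v\<in>T d. mass n v)" by simp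
    qed
    also have "\<dots> = (\<Sum>d\<in>M. \<Sum>v\<in>T d. mass n (d # v))"
      by (simp add: sum_distrib_left)
    also have "\<dots> = (\<Sum>(d, v)\<in>Sigma M T. mass n (d # v))"
      using fin finT by (intro sum.Sigma) auto
    also have "\<dots> = (\<Sum>v\<in>(\<lambda>(d, v). d # v) ` Sigma M T. mass n v)"
      by (subst sum.reindex) (auto simp: inj_on_def case_prod_unfold)
    also have "\<dots> \<le> (\<Sum>v | v \<in> S \<and> crossed_path n v h r. mass n v)"
      using Suc.prems(1,2) by (intro sum_mono2) (auto simp: M_def T_def intro: mass_nonneg)
    finally show ?thesis .
  qed
qed

lemma crossed_path_exists:
  assumes "crossed h r"
  shows "\<exists>w. length w = k \<and> crossed_path n w h r"
  using assms
proof (induction k arbitrary: h)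
  case (Suc k)
  have "{d. d \<in> strip n \<and> crossed (\<lambda>z. h (place n d z)) r} \<noteq> {}"
  proof
    assume "{d. d \<in> strip n \<and> crossed (\<lambda>z. h (place n d z)) r} = {}"
    with sum_weight_crossed[OF Suc.prems] show False by simp
  qed
  then obtain d where d: "d \<in> strip n" "crossed (\<lambda>z. h (place n d z)) r" by blast
  obtain w where "length w = k" "crossed_path n w (\<lambda>z. h (place n d z)) r"
    using Suc.IH[OF d(2)] by blast
  then show ?case using d Suc.prems by (intro exI[of _ "d # w"]) simp
qed (intro exI[of _ "[]"], simp)

section \<open>Geometry of the small squares\<close>

lemma address_F: "set w \<subseteq> digits n \<Longrightarrow> x \<in> F \<Longrightarrow> address n w x \<in> F"
  by (induction w) (auto intro: place_F)

lemma dist_address: "dist (address n w x) (address n w y) = dist x y / real n ^ length w"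
  by (induction w) (simp_all add: dist_place n_pos field_simps)

lemma dist_F_le: "x \<in> F \<Longrightarrow> y \<in> F \<Longrightarrow> dist x y \<le> 2"
proof -
  assume "x \<in> F" "y \<in> F"
  then have "x \<in> unit_square" "y \<in> unit_square" using F_subset by auto
  then have "\<bar>fst x - fst y\<bar> \<le> 1" "\<bar>snd x - snd y\<bar> \<le> 1"
    by (auto simp: unit_square_def)
  moreover have "dist x y \<le> \<bar>fst x - fst y\<bar> + \<bar>snd x - snd y\<bar>"
    using sqrt_sum_squares_le_sum_abs[of "fst x - fst y" "snd x - snd y"]
    by (simp add: dist_prod_def dist_real_def)
  ultimately show "dist x y \<le> 2" by linarith
qed

lemma address_cover:
  assumes "x \<in> F"
  shows "\<exists>w y. length w = k \<and> set w \<subseteq> digits n \<and> y \<in> F \<and> x = address n w y"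
  using assms
proof (induction k arbitrary: x)
  case (Suc k)
  then obtain d y where d: "d \<in> digits n" "y \<in> F" "x = place n d y" using F_eq by blast
  obtain w z where "length w = k" "set w \<subseteq> digits n" "z \<in> F" "y = address n w z"
    using Suc.IH[OF d(2)] by blast
  then show ?case using d by (intro exI[of _ "d # w"] exI[of _ z]) auto
qed auto

lemma address_eq:
  "address n w z = ((fst z + real (base_val n (map fst w))) / real n ^ length w,
     (snd z + real (base_val n (map snd w))) / real n ^ length w)"
  by (induction w) (use n_pos in \<open>simp_all add: place_def field_simps\<close>)

text \<open>A word is determined by its two integer coordinates, and a set no larger than a square
  of level \<open>k\<close> leaves at most four possibilities for each of them.\<close>

lemma card_meeting_le:
  assumes A: "\<And>x y. x \<in> A \<Longrightarrow> y \<in> A \<Longrightarrow> dist x y \<le> 1 / real n ^ k"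
  shows "finite {w. length w = k \<and> set w \<subseteq> digits n \<and> address n w ` F \<inter> A \<noteq> {}}" (is "finite ?W")
    and "card {w. length w = k \<and> set w \<subseteq> digits n \<and> address n w ` F \<inter> A \<noteq> {}} \<le> 16"
proof -
  define \<beta> where "\<beta> w = (base_val n (map fst w), base_val n (map snd w))" for w :: "(nat \<times> nat) list"
  have inj: "inj_on \<beta> ?W"
  proof (rule inj_onI)
    fix v w assume vw: "v \<in> ?W" "w \<in> ?W" and eq: "\<beta> v = \<beta> w"
    have lt: "set (map fst u) \<subseteq> {..<n}" "set (map snd u) \<subseteq> {..<n}" if "u \<in> ?W" for u
      using that by (auto simp: digits_def)
    have "map fst v = map fst w" "map snd v = map snd w"
      using base_val_inject[OF _ lt(1)[OF vw(1)] lt(1)[OF vw(2)]]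
        base_val_inject[OF _ lt(2)[OF vw(1)] lt(2)[OF vw(2)]] eq vw by (auto simp: \<beta>_def)
    then show "v = w" by (metis zip_map_fst_snd)
  qed
  have "finite (\<beta> ` ?W) \<and> card (\<beta> ` ?W) \<le> 16"
  proof (cases "A = {}")
    case False
    then obtain a where a: "a \<in> A" by blast
    \<comment> \<open>With an offset \<open>t\<close> in the unit interval and an error of at most 1
      after scaling, the coordinate \<open>b\<close> lies between \<open>n ^ k * s - 2\<close> and
      \<open>n ^ k * s + 1\<close>. Truncation by \<open>nat\<close> is harmless since
      \<open>b\<close> is a natural number.\<close>
    define c where "c s = nat \<lceil>real n ^ k * s - 2\<rceil>" for s
    have near: "b \<in> {c s..c s + 3}"
      if t: "\<bar>(t + real b) / real n ^ k - s\<bar> \<le> 1 / real n ^ k" "0 \<le> t" "t \<le> 1" for b t s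
    proof -
      have "\<bar>(t + real b) / real n ^ k - s\<bar> * real n ^ k \<le> 1 / real n ^ k * real n ^ k"
        using t(1) by (intro mult_right_mono) auto
      also have "\<bar>(t + real b) / real n ^ k - s\<bar> * real n ^ k
          = \<bar>((t + real b) / real n ^ k - s) * real n ^ k\<bar>"
        by (simp add: abs_mult)
      also have "((t + real b) / real n ^ k - s) * real n ^ k = t + real b - real n ^ k * s"
        using n_pos by (simp add: field_simps)
      finally have "\<bar>t + real b - real n ^ k * s\<bar> \<le> 1" using n_pos by simp
      then have "real n ^ k * s - 2 \<le> real b" "real b \<le> real n ^ k * s + 1" using t by linarith+
      moreover have "real n ^ k * s - 2 \<le> real (c s)" unfolding c_def by linarith
      moreover have "\<lceil>real n ^ k * s - 2\<rceil> \<le> int b"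
        using calculation(1) by (simp only: ceiling_le_iff of_int_of_nat_eq)
      then have "c s \<le> b" unfolding c_def by linarith
      ultimately show ?thesis by auto
    qed
    have sub: "\<beta> ` ?W \<subseteq> {c (fst a)..c (fst a) + 3} \<times> {c (snd a)..c (snd a) + 3}"
    proof
      fix p assume "p \<in> \<beta> ` ?W"
      then obtain w where w0: "p = \<beta> w" "w \<in> ?W" by blast
      then obtain z where w: "p = \<beta> w" "length w = k" "z \<in> F" "address n w z \<in> A" by blast
      have z: "fst z \<in> {0..1}" "snd z \<in> {0..1}" using w(3) F_subset by (auto simp: unit_square_def)
      have d: "dist (address n w z) a \<le> 1 / real n ^ k" using A[OF w(4) a] .
      have "\<bar>fst (address n w z) - fst a\<bar> \<le> 1 / real n ^ k" "\<bar>snd (address n w z) - snd a\<bar> \<le> 1 / real n ^ k"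
        using d dist_fst_le[of "address n w z" a] dist_snd_le[of "address n w z" a]
        by (auto simp: dist_real_def)
      then show "p \<in> {c (fst a)..c (fst a) + 3} \<times> {c (snd a)..c (snd a) + 3}"
        using near z unfolding w(1) \<beta>_def address_eq w(2) by auto
    qed
    have "card (\<beta> ` ?W) \<le> card ({c (fst a)..c (fst a) + 3} \<times> {c (snd a)..c (snd a) + 3})"
      by (rule card_mono[OF _ sub]) auto
    then show ?thesis using finite_subset[OF sub] by (simp add: card_cartesian_product)
  qed simp
  then show "finite ?W" "card ?W \<le> 16"
    using inj by (simp_all add: finite_image_iff card_image)
qed

end


section \<open>Exceptional values have small mass\<close>

definition holder_on :: "real \<Rightarrow> 'a::metric_space set \<Rightarrow> ('a \<Rightarrow> real) \<Rightarrow> bool" where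
  "holder_on \<alpha> S h \<longleftrightarrow> (\<forall>a\<in>S. \<forall>b\<in>S. \<bar>h a - h b\<bar> \<le> dist a b powr \<alpha>)"

definition bad_count :: "nat \<Rightarrow> (nat \<times> nat) list \<Rightarrow> nat" where
  "bad_count n w = length (filter (\<lambda>d. d \<in> bad n) w)"

definition bad_words :: "nat \<Rightarrow> nat \<Rightarrow> (nat \<times> nat) list set" where
  "bad_words n k = {w. set w \<subseteq> strip n \<and> length w = k \<and> k < 4 * bad_count n w}"

text \<open>Only the last square has to be crossed, not the whole path. This bounds the mass of the
  bad crossed paths from above, and as a function of \<open>r\<close> it is a finite combination of
  indicators of simple sets.\<close>

definition bad_mass :: "nat \<Rightarrow> (real \<times> real \<Rightarrow> real) \<Rightarrow> nat \<Rightarrow> real \<Rightarrow> real" where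
  "bad_mass n h k r =
     (\<Sum>w\<in>bad_words n k. mass n w * indicator {r. crossed (\<lambda>z. h (address n w z)) r} r)"

lemma sum_prod_list_words:
  fixes g :: "'a \<Rightarrow> real"
  assumes "finite L"
  shows "(\<Sum>w | set w \<subseteq> L \<and> length w = k. prod_list (map g w)) = (\<Sum>d\<in>L. g d) ^ k"
proof (induction k)
  case 0
  have "{w. set w \<subseteq> L \<and> length w = 0} = {[]}" by auto
  then show ?case by simp
next
  case (Suc k)
  have "(\<Sum>w | set w \<subseteq> L \<and> length w = Suc k. prod_list (map g w))
      = (\<Sum>(w, d)\<in>{w. set w \<subseteq> L \<and> length w = k} \<times> L. prod_list (map g (d # w)))"
    unfolding lists_length_Suc_eq
    by (subst sum.reindex) (auto simp: inj_on_def case_prod_unfold)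
  also have "\<dots> = (\<Sum>w | set w \<subseteq> L \<and> length w = k. \<Sum>d\<in>L. g d * prod_list (map g w))"
    by (subst sum.cartesian_product) simp
  also have "\<dots> = (\<Sum>d\<in>L. g d) * (\<Sum>w | set w \<subseteq> L \<and> length w = k. prod_list (map g w))"
    by (simp add: sum_distrib_left sum_distrib_right mult.commute)
  finally show ?case using Suc by simp
qed

lemma bad_count_Nil [simp]: "bad_count n [] = 0"
  and bad_count_Cons [simp]: "bad_count n (d # w) = (if d \<in> bad n then 1 else 0) + bad_count n w"
  by (auto simp: bad_count_def)

lemma bad_count_le: "bad_count n w \<le> length w"
  by (simp add: bad_count_def)

lemma mass_eq: "mass n w = (1/4) ^ (length w - bad_count n w)"
proof (induction w)
  case (Cons d w)
  then show ?case using bad_count_le[of n w] by (simp add: weight_def Suc_diff_le)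
qed simp

lemma mass_le_of_few_bad:
  assumes "4 * bad_count n w \<le> length w"
  shows "mass n w \<le> 2 powr (- (3/2) * real (length w))"
proof -
  define j where "j = length w - bad_count n w"
  have j: "3 * length w \<le> 4 * j" using assms by (simp add: j_def)
  have "mass n w = (2 powr (-2)) ^ j" unfolding mass_eq j_def by (simp add: powr_minus powr_numeral)
  also have "\<dots> = 2 powr (-2 * real j)" by (simp add: powr_powr flip: powr_realpow)
  also have "\<dots> \<le> 2 powr (- (3/2) * real (length w))"
    using j by (intro powr_mono) auto
  finally show ?thesis .
qed

lemma mass_mult_power:
  "mass n w * x ^ bad_count n w = prod_list (map (\<lambda>d. weight n d * (if d \<in> bad n then x else 1)) w)"
  by (induction w) (auto simp: mult_ac)

text \<open>The set is the union of the half-open intervals from \<open>h a\<close> to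
  \<open>h b\<close> over the 16 ordered pairs of corners.\<close>

lemma crossed_sets_borel: "{r. crossed h r} \<in> sets borel"
  and emeasure_crossed_le:
    "(\<And>a b. a \<in> {0, 1} \<times> {0, 1} \<Longrightarrow> b \<in> {0, 1} \<times> {0, 1} \<Longrightarrow> \<bar>h a - h b\<bar> \<le> e) \<Longrightarrow>
      emeasure lborel {r. crossed h r} \<le> ennreal (16 * e)"
proof -
  let ?C = "{0, 1} \<times> {0, 1} :: (real \<times> real) set"
  have eq: "{r. crossed h r} = (\<Union>p\<in>?C \<times> ?C. {h (fst p)..<h (snd p)})"
    unfolding crossed_def by auto
  show "{r. crossed h r} \<in> sets borel"
    unfolding eq by (intro sets.finite_UN) auto
  assume e: "\<And>a b. a \<in> {0, 1} \<times> {0, 1} \<Longrightarrow> b \<in> {0, 1} \<times> {0, 1} \<Longrightarrow> \<bar>h a - h b\<bar> \<le> e"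
  have "emeasure lborel {r. crossed h r} \<le> (\<Sum>p\<in>?C \<times> ?C. emeasure lborel {h (fst p)..<h (snd p)})"
    unfolding eq by (intro emeasure_subadditive_finite) auto
  also have "\<dots> \<le> (\<Sum>p\<in>?C \<times> ?C. ennreal e)"
  proof (rule sum_mono)
    fix p assume "p \<in> ?C \<times> ?C"
    then have "h (snd p) - h (fst p) \<le> e"
      using e[of "fst p" "snd p"] by (auto simp: abs_le_iff)
    then show "emeasure lborel {h (fst p)..<h (snd p)} \<le> ennreal e"
      by (cases "h (fst p) \<le> h (snd p)") (auto intro: ennreal_leI)
  qed
  also have "\<dots> = ennreal (16 * e)"
  proof -
    have "0 \<le> e" using e[of "(0, 0)" "(0, 0)"] by simp
    moreover have "card (?C \<times> ?C) = 16" by (simp add: card_cartesian_product)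
    ultimately show ?thesis
      by (simp only: sum_constant) (simp add: ennreal_mult)
  qed
  finally show "emeasure lborel {r. crossed h r} \<le> ennreal (16 * e)" .
qed

lemma holder_on_imp_continuous_on:
  assumes "holder_on \<alpha> S h" "0 < \<alpha>"
  shows "continuous_on S h"
  unfolding continuous_on_iff
proof (intro ballI allI impI)
  fix x and e :: real assume x: "x \<in> S" and e: "0 < e"
  show "\<exists>d>0. \<forall>y\<in>S. dist y x < d \<longrightarrow> dist (h y) (h x) < e"
  proof (intro exI[of _ "e powr (1 / \<alpha>)"] conjI ballI impI)
    show "0 < e powr (1 / \<alpha>)" using e by simp
    fix y assume y: "y \<in> S" "dist y x < e powr (1 / \<alpha>)"
    have "dist (h y) (h x) \<le> dist y x powr \<alpha>"
      using assms(1) x y(1) by (simp add: holder_on_def dist_real_def)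
    also have "\<dots> < (e powr (1 / \<alpha>)) powr \<alpha>"
      using y(2) assms(2) by (intro powr_less_mono2) auto
    also have "\<dots> = e" using e assms(2) by (simp add: powr_powr)
    finally show "dist (h y) (h x) < e" .
  qed
qed

context grid_fractal
begin

lemma finite_bad_words: "finite (bad_words n k)"
  by (rule finite_subset[OF _ finite_lists_length_eq[OF finite_strip, of k]]) (auto simp: bad_words_def)

lemma bad_mass_nonneg: "0 \<le> bad_mass n h k r"
  unfolding bad_mass_def by (intro sum_nonneg mult_nonneg_nonneg mass_nonneg) auto

lemma holder_address:
  assumes h: "holder_on \<alpha> F h" and \<alpha>: "0 < \<alpha>" and w: "set w \<subseteq> digits n" and ab: "a \<in> F" "b \<in> F"
  shows "\<bar>h (address n w a) - h (address n w b)\<bar> \<le> (2 / real n ^ length w) powr \<alpha>"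
proof -
  have "\<bar>h (address n w a) - h (address n w b)\<bar> \<le> dist (address n w a) (address n w b) powr \<alpha>"
    using h address_F[OF w] ab by (simp add: holder_on_def)
  also have "\<dots> \<le> (2 / real n ^ length w) powr \<alpha>"
    unfolding dist_address using dist_F_le[OF ab] \<alpha> by (intro powr_mono2 divide_right_mono) auto
  finally show ?thesis .
qed

lemma holder_on_address:
  assumes h: "holder_on \<alpha> F h" and \<alpha>: "0 < \<alpha>" and w: "set w \<subseteq> digits n"
  shows "holder_on \<alpha> F (\<lambda>z. h (address n w z))"
  unfolding holder_on_def
proof (intro ballI)
  fix a b assume ab: "a \<in> F" "b \<in> F"
  have "\<bar>h (address n w a) - h (address n w b)\<bar> \<le> dist (address n w a) (address n w b) powr \<alpha>"
    using h address_F[OF w] ab by (simp add: holder_on_def)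
  also have "dist (address n w a) (address n w b) \<le> dist a b"
    unfolding dist_address using n_pos by (simp add: divide_le_eq mult_le_cancel_left1 one_le_power)
  then have "dist (address n w a) (address n w b) powr \<alpha> \<le> dist a b powr \<alpha>"
    using \<alpha> by (intro powr_mono2) auto
  finally show "\<bar>h (address n w a) - h (address n w b)\<bar> \<le> dist a b powr \<alpha>" .
qed

lemma small_cells:
  assumes "0 < \<alpha>" "0 < e"
  shows "\<exists>k. (2 / real n ^ k) powr \<alpha> < e"
proof -
  obtain k where k: "(1 / real n) ^ k < e powr (1 / \<alpha>) / 2"
    using real_arch_pow_inv[of "e powr (1 / \<alpha>) / 2" "1 / real n"] assms n_pos by auto
  have "2 / real n ^ k < e powr (1 / \<alpha>)"
    using k by (simp add: power_one_over divide_simps mult.commute)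
  then have "(2 / real n ^ k) powr \<alpha> < (e powr (1 / \<alpha>)) powr \<alpha>"
    using assms by (intro powr_less_mono2) auto
  also have "\<dots> = e" using assms by (simp add: powr_powr)
  finally show ?thesis by blast
qed

text \<open>An intermediate value property obtained from crossed paths. They lead to squares of
  arbitrarily small oscillation whose corner values lie on both sides of \<open>r\<close>, so the
  minimum of \<open>\<bar>h x - r\<bar>\<close> over the compact set \<open>F\<close> is 0.\<close>

lemma crossed_imp_level:
  assumes h: "holder_on \<alpha> F h" and \<alpha>: "0 < \<alpha>" and cr: "crossed h r"
  shows "\<exists>x\<in>F. h x = r"
proof -
  have "continuous_on F (\<lambda>x. \<bar>h x - r\<bar>)"
    using holder_on_imp_continuous_on[OF h \<alpha>] by (intro continuous_intros)
  then obtain x where x: "x \<in> F" "\<And>y. y \<in> F \<Longrightarrow> \<bar>h x - r\<bar> \<le> \<bar>h y - r\<bar>"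
    using continuous_attains_inf[OF compact_F F_nonempty] by blast
  have "\<bar>h x - r\<bar> = 0"
  proof (rule ccontr)
    assume "\<bar>h x - r\<bar> \<noteq> 0"
    then obtain k where k: "(2 / real n ^ k) powr \<alpha> < \<bar>h x - r\<bar>"
      using small_cells[OF \<alpha>, of "\<bar>h x - r\<bar>"] by auto
    obtain w where w: "length w = k" "crossed_path n w h r" using crossed_path_exists[OF cr] by blast
    have wd: "set w \<subseteq> digits n" using crossed_path_imp_strip[OF w(2)] strip_subset_digits by blast
    obtain a b where ab: "a \<in> {0, 1} \<times> {0, 1}" "b \<in> {0, 1} \<times> {0, 1}"
      "h (address n w a) \<le> r" "r < h (address n w b)"
      using crossed_path_imp_crossed[OF w(2)] unfolding crossed_def by blast
    have F: "a \<in> F" "b \<in> F" using ab corners_in_F by auto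
    have "\<bar>h (address n w a) - h (address n w b)\<bar> < \<bar>h x - r\<bar>"
      using holder_address[OF h \<alpha> wd F] k w(1) by simp
    moreover have "\<bar>h x - r\<bar> \<le> \<bar>h (address n w a) - r\<bar>" using x(2) address_F[OF wd F(1)] .
    ultimately show False using ab(3,4) by linarith
  qed
  then show ?thesis using x(1) by auto
qed

text \<open>An exponential Markov bound. On bad words the factor
  \<open>n powr (bad_count - k/4)\<close> is at least 1; with it inserted, the sum extends to all
  words over the strip and factorises into \<open>k\<close> equal sums. Each is at most
  \<open>40 * n + (8 * n) / 4 = 42 * n\<close>, from 40 bad squares of weight 1 and at most
  \<open>8 * n\<close> others of weight 1/4.\<close>

lemma sum_mass_bad_words:
  "(\<Sum>w\<in>bad_words n k. mass n w) \<le> (42 * real n) ^ k * real n powr (- real k / 4)"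
proof -
  define g where "g d = weight n d * (if d \<in> bad n then real n else 1)" for d
  have g0: "0 \<le> g d" for d using weight_pos[of n d] n_pos by (simp add: g_def)
  have g1: "g d = (if d \<in> bad n then real n else 1/4)" for d by (simp add: g_def weight_def)
  have "(\<Sum>d\<in>strip n. g d) = (\<Sum>d\<in>bad n. g d) + (\<Sum>d\<in>strip n - bad n. g d)"
    using sum.subset_diff[OF bad_subset_strip[OF n8] finite_strip, of g] by (simp add: add.commute)
  also have "(\<Sum>d\<in>bad n. g d) = real (card (bad n)) * real n" by (simp add: g1)
  also have "\<dots> \<le> 40 * real n" using card_bad[of n] by (intro mult_right_mono) auto
  also have "(\<Sum>d\<in>strip n - bad n. g d) = real (card (strip n - bad n)) * (1/4)" by (simp add: g1)
  also have "\<dots> \<le> real (8 * n) * (1/4)"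
    using card_mono[OF finite_strip, of "strip n - bad n"] card_strip[of n]
    by (intro mult_right_mono of_nat_mono) auto
  finally have g42: "(\<Sum>d\<in>strip n. g d) \<le> 42 * real n" by simp
  have "(\<Sum>w\<in>bad_words n k. mass n w)
      \<le> (\<Sum>w\<in>bad_words n k. mass n w * real n ^ bad_count n w * real n powr (- real k / 4))"
  proof (rule sum_mono)
    fix w assume "w \<in> bad_words n k"
    then have "0 \<le> real (bad_count n w) + - real k / 4" by (auto simp: bad_words_def)
    then have "1 \<le> real n powr (real (bad_count n w) + - real k / 4)"
      using n_pos by (intro ge_one_powr_ge_zero) auto
    also have "\<dots> = real n ^ bad_count n w * real n powr (- real k / 4)"
      using n_pos by (simp only: powr_add powr_realpow)
    finally have "mass n w * 1 \<le> mass n w * (real n ^ bad_count n w * real n powr (- real k / 4))"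
      by (rule mult_left_mono[OF _ mass_nonneg])
    then show "mass n w \<le> mass n w * real n ^ bad_count n w * real n powr (- real k / 4)"
      by (simp add: mult_ac)
  qed
  also have "\<dots> = (\<Sum>w\<in>bad_words n k. prod_list (map g w)) * real n powr (- real k / 4)"
    unfolding g_def mass_mult_power by (simp add: sum_distrib_right)
  also have "(\<Sum>w\<in>bad_words n k. prod_list (map g w))
      \<le> (\<Sum>w | set w \<subseteq> strip n \<and> length w = k. prod_list (map g w))"
    using finite_lists_length_eq[OF finite_strip, of k]
    by (intro sum_mono2) (auto simp: bad_words_def intro!: prod_list_nonneg g0)
  also have "\<dots> = (\<Sum>d\<in>strip n. g d) ^ k" by (rule sum_prod_list_words[OF finite_strip])
  also have "\<dots> \<le> (42 * real n) ^ k"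
    using g42 g0 by (intro power_mono sum_nonneg) auto
  finally show ?thesis by (simp add: mult_right_mono)
qed

text \<open>A square of level \<open>k\<close> is crossed on a set of measure at most
  \<open>16 * (2 / n ^ k) powr \<alpha>\<close>, and \<open>\<alpha> \<le> 1\<close> bounds this by
  \<open>32 * n powr (- k * \<alpha>)\<close>. Multiplication by the total mass of the bad words
  gives a geometric term in \<open>k\<close>.\<close>

lemma nn_integral_bad_mass:
  assumes h: "holder_on \<alpha> F h" and \<alpha>: "0 < \<alpha>" "\<alpha> \<le> 1"
  shows "(\<integral>\<^sup>+ r. ennreal (bad_mass n h k r) \<partial>lborel) \<le> ennreal (32 * (42 * real n powr (3/4 - \<alpha>)) ^ k)"
proof -
  define E where "E w = {r. crossed (\<lambda>z. h (address n w z)) r}" for w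
  have E: "E w \<in> sets lborel" for w unfolding E_def by (simp add: crossed_sets_borel)
  have em: "emeasure lborel (E w) \<le> ennreal (32 * real n powr (- real k * \<alpha>))" if "w \<in> bad_words n k" for w
  proof -
    have w: "set w \<subseteq> digits n" "length w = k"
      using that strip_subset_digits by (auto simp: bad_words_def)
    have "emeasure lborel (E w) \<le> ennreal (16 * (2 / real n ^ k) powr \<alpha>)"
      unfolding E_def using holder_address[OF h \<alpha>(1) w(1)] corners_in_F w(2)
      by (intro emeasure_crossed_le) blast
    also have "(2 / real n ^ k) powr \<alpha> = 2 powr \<alpha> * (real n powr (- real k)) powr \<alpha>"
      using n_pos by (simp add: powr_divide powr_minus powr_realpow inverse_eq_divide)
    also have "\<dots> \<le> 2 powr 1 * (real n powr (- real k)) powr \<alpha>"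
      using \<alpha> by (intro mult_right_mono powr_mono) auto
    also have "(real n powr (- real k)) powr \<alpha> = real n powr (- real k * \<alpha>)"
      by (simp add: powr_powr)
    finally show ?thesis by (simp add: ennreal_leI)
  qed
  have "(\<integral>\<^sup>+ r. ennreal (bad_mass n h k r) \<partial>lborel)
      = (\<integral>\<^sup>+ r. (\<Sum>w\<in>bad_words n k. ennreal (mass n w) * indicator (E w) r) \<partial>lborel)"
  proof (rule nn_integral_cong)
    fix r
    have "ennreal (bad_mass n h k r) = (\<Sum>w\<in>bad_words n k. ennreal (mass n w * indicator (E w) r))"
      unfolding bad_mass_def E_def
      by (rule sum_ennreal[symmetric]) (intro mult_nonneg_nonneg mass_nonneg, auto)
    also have "\<dots> = (\<Sum>w\<in>bad_words n k. ennreal (mass n w) * indicator (E w) r)"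
      by (intro sum.cong) (auto simp: indicator_def)
    finally show "ennreal (bad_mass n h k r) = (\<Sum>w\<in>bad_words n k. ennreal (mass n w) * indicator (E w) r)" .
  qed
  also have "\<dots> = (\<Sum>w\<in>bad_words n k. ennreal (mass n w) * emeasure lborel (E w))"
    using E by (subst nn_integral_sum) (auto simp: nn_integral_cmult_indicator)
  also have "\<dots> \<le> (\<Sum>w\<in>bad_words n k. ennreal (mass n w) * ennreal (32 * real n powr (- real k * \<alpha>)))"
    using em by (intro sum_mono mult_left_mono) auto
  also have "\<dots> = ennreal ((\<Sum>w\<in>bad_words n k. mass n w) * (32 * real n powr (- real k * \<alpha>)))"
    by (simp add: sum_distrib_right mass_nonneg ennreal_mult[symmetric] sum_ennreal)
  also have "\<dots> \<le> ennreal (32 * (42 * real n powr (3/4 - \<alpha>)) ^ k)"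
  proof (rule ennreal_leI)
    have "(\<Sum>w\<in>bad_words n k. mass n w) * (32 * real n powr (- real k * \<alpha>))
        \<le> ((42 * real n) ^ k * real n powr (- real k / 4)) * (32 * real n powr (- real k * \<alpha>))"
      by (rule mult_right_mono[OF sum_mass_bad_words]) simp
    also have "\<dots> = 32 * 42 ^ k * (real n powr real k * real n powr (- real k / 4) * real n powr (- real k * \<alpha>))"
      using n_pos by (simp add: power_mult_distrib powr_realpow)
    also have "\<dots> = 32 * 42 ^ k * real n powr (real k + - real k / 4 + - real k * \<alpha>)"
      by (simp only: powr_add)
    also have "real k + - real k / 4 + - real k * \<alpha> = (3/4 - \<alpha>) * real k"
      by (simp add: algebra_simps)
    also have "real n powr ((3/4 - \<alpha>) * real k) = (real n powr (3/4 - \<alpha>)) ^ k"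
      using n_pos by (simp add: powr_powr[symmetric] powr_realpow)
    finally show "(\<Sum>w\<in>bad_words n k. mass n w) * (32 * real n powr (- real k * \<alpha>))
        \<le> 32 * (42 * real n powr (3/4 - \<alpha>)) ^ k" by (simp add: power_mult_distrib mult_ac)
  qed
  finally show ?thesis .
qed

lemma bad_mass_measurable: "bad_mass n h k \<in> borel_measurable lborel"
  unfolding bad_mass_def
  by (intro borel_measurable_sum borel_measurable_times borel_measurable_indicator)
    (auto simp: crossed_sets_borel)

text \<open>A Borel-Cantelli argument: the integrals are dominated by a geometric series, so the
  series of bad masses has a finite integral and converges almost everywhere.\<close>

lemma AE_summable_bad_mass:
  assumes h: "holder_on \<alpha> F h" and \<alpha>: "0 < \<alpha>" "\<alpha> \<le> 1" and q: "42 * real n powr (3/4 - \<alpha>) \<le> 1/2"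
  shows "AE r in lborel. summable (\<lambda>k. bad_mass n h k r)"
proof -
  define q where "q = 42 * real n powr (3/4 - \<alpha>)"
  have q01: "0 \<le> q" "q < 1" using q by (auto simp: q_def)
  have "(\<integral>\<^sup>+ r. (\<Sum>k. ennreal (bad_mass n h k r)) \<partial>lborel) = (\<Sum>k. \<integral>\<^sup>+ r. ennreal (bad_mass n h k r) \<partial>lborel)"
    using bad_mass_measurable by (intro nn_integral_suminf) auto
  also have "\<dots> \<le> (\<Sum>k. ennreal (32 * q ^ k))"
    using nn_integral_bad_mass[OF h \<alpha>] unfolding q_def by (intro suminf_le) auto
  also have "\<dots> = ennreal (\<Sum>k. 32 * q ^ k)"
    using q01 by (intro suminf_ennreal2 summable_mult summable_geometric) auto
  also have "\<dots> < \<infinity>" by simp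
  finally have "AE r in lborel. (\<Sum>k. ennreal (bad_mass n h k r)) \<noteq> \<infinity>"
    using bad_mass_measurable by (intro nn_integral_PInf_AE) auto
  then show ?thesis
    by eventually_elim (auto intro: summable_suminf_not_top bad_mass_nonneg)
qed

end


section \<open>Dimension of almost every level set\<close>

lemma sum_UN_le:
  fixes f :: "'a \<Rightarrow> real"
  assumes "finite I" "\<And>i. i \<in> I \<Longrightarrow> finite (A i)" "\<And>x. 0 \<le> f x"
  shows "sum f (\<Union>i\<in>I. A i) \<le> (\<Sum>i\<in>I. sum f (A i))"
  using assms(1,2)
proof (induction I rule: finite_induct)
  case (insert i I)
  have "sum f (\<Union>j\<in>insert i I. A j) \<le> sum f (A i) + sum f (\<Union>j\<in>I. A j)"
    using sum.union_inter[of "A i" "\<Union>j\<in>I. A j" f] insert sum_nonneg[of "A i \<inter> (\<Union>j\<in>I. A j)" f] assms(3)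
    by simp
  then show ?case using insert by simp
qed simp

context grid_fractal
begin

text \<open>This is \<open>3/(2m)\<close> for \<open>n = 2^m\<close>.\<close>

definition dim_bound :: real where
  "dim_bound = 3/2 * ln 2 / ln (real n)"

lemma dim_bound_pos: "0 < dim_bound"
  using n_pos by (simp add: dim_bound_def)

lemma powr_dim_bound: "real n powr dim_bound = 2 powr (3/2)"
  using n_pos by (simp add: powr_def dim_bound_def)

text \<open>Selects the level whose side length is comparable to \<open>D\<close>: the last one
  before the side length \<open>1 / n ^ j\<close> falls below \<open>D\<close>.\<close>

lemma scale_exists:
  assumes D: "0 < D" "D < 1 / real n ^ k0"
  shows "\<exists>k\<ge>k0. D \<le> 1 / real n ^ k \<and> 1 / real n ^ k \<le> real n * D"
proof -
  define j where "j = (LEAST j. 1 / real n ^ j < D)"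
  have "\<exists>j. (1 / real n) ^ j < D"
    using real_arch_pow_inv[OF D(1), of "1 / real n"] n_pos by simp
  then have j: "1 / real n ^ j < D"
    unfolding j_def power_one_over by (rule LeastI_ex)
  have "k0 < j"
  proof (rule ccontr)
    assume "\<not> k0 < j"
    then have "real n ^ j \<le> real n ^ k0" using n_pos by (intro power_increasing) auto
    then have "1 / real n ^ k0 \<le> 1 / real n ^ j" using n_pos by (intro divide_left_mono) auto
    then show False using j D by linarith
  qed
  then obtain k where k: "j = Suc k" "k0 \<le> k" by (metis less_Suc_eq_le not0_implies_Suc not_less0)
  have "\<not> 1 / real n ^ k < D"
    using not_less_Least[of k "\<lambda>j. 1 / real n ^ j < D"] k(1) unfolding j_def by simp
  moreover have "1 / real n ^ k \<le> real n * D"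
    using j n_pos unfolding k(1) by (simp add: field_simps)
  ultimately show ?thesis using k(2) by (intro exI[of _ k]) auto
qed

text \<open>A cover of the level set is replaced by words of comparable size. Every long crossed
  path leads to a point of the level set and thus has a prefix among these words. Bad prefixes
  account for less than half of the mass, so the others carry more than 1/2, while each covering set
  contributes at most 16 words of small mass.\<close>

lemma hausdorff_dim_level_ge:
  assumes h: "holder_on \<alpha> F h" and \<alpha>: "0 < \<alpha>" and cr: "crossed h r"
    and sm: "summable (\<lambda>k. bad_mass n h k r)"
  shows "ereal dim_bound \<le> hausdorff_dim {x \<in> F. h x = r}"
proof -
  \<comment> \<open>From level \<open>k0\<close> on, the bad words carry less than half of the unit
    mass. Covering sets smaller than \<open>1 / n ^ k0\<close> only involve such levels.\<close>
  obtain k0 where Cauchy: "\<forall>j\<ge>k0. \<forall>K. norm (\<Sum>k=j..<K. bad_mass n h k r) < 1/2"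
    using sm unfolding summable_Cauchy by (meson half_gt_zero zero_less_one)
  have k0: "(\<Sum>k=k0..<K. bad_mass n h k r) < 1/2" for K
    using Cauchy[rule_format, OF order.refl, of K] unfolding real_norm_def by linarith
  show ?thesis
  proof (rule hausdorff_dim_ge[where c = "1 / (32 * 2 powr (3/2))" and \<delta> = "1 / real n ^ k0"])
    have "closed {x \<in> F. h x = r}"
      using holder_on_imp_continuous_on[OF h \<alpha>] compact_F
      by (intro continuous_closed_preimage_constant compact_imp_closed)
    moreover have "bounded {x \<in> F. h x = r}"
      by (rule bounded_subset[OF compact_imp_bounded[OF compact_F]]) auto
    ultimately show "compact {x \<in> F. h x = r}" by (simp add: compact_eq_bounded_closed)
    show "0 < dim_bound" by (rule dim_bound_pos)
    show "0 < 1 / real n ^ k0" using n_pos by simp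
    fix I :: "nat set" and V D
    assume I: "finite I" and cov: "{x \<in> F. h x = r} \<subseteq> (\<Union>i\<in>I. V i)"
      and VD: "\<And>i. i \<in> I \<Longrightarrow> 0 < D i \<and> D i < 1 / real n ^ k0 \<and> (\<forall>x\<in>V i. \<forall>y\<in>V i. dist x y \<le> D i)"
    have "\<forall>i\<in>I. \<exists>k\<ge>k0. D i \<le> 1 / real n ^ k \<and> 1 / real n ^ k \<le> real n * D i"
      using scale_exists VD by blast
    then obtain \<kappa> where \<kappa>: "\<And>i. i \<in> I \<Longrightarrow> k0 \<le> \<kappa> i" "\<And>i. i \<in> I \<Longrightarrow> D i \<le> 1 / real n ^ \<kappa> i"
      "\<And>i. i \<in> I \<Longrightarrow> 1 / real n ^ \<kappa> i \<le> real n * D i" by metis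
    \<comment> \<open>Above every \<open>\<kappa> i\<close>: a word of length \<open>K\<close> then
      has a prefix of each of these lengths, and each \<open>\<kappa> i\<close> lies in the
      half-open range \<open>{k0..<K}\<close>.\<close>
    define K where "K = Suc (Max (insert k0 (\<kappa> ` I)))"
    have K: "\<kappa> i < K" if "i \<in> I" for i
      using that I unfolding K_def by (simp add: less_Suc_eq_le)
    define N where "N i = {v. length v = \<kappa> i \<and> set v \<subseteq> digits n \<and> address n v ` F \<inter> V i \<noteq> {}}" for i
    have N: "finite (N i)" "card (N i) \<le> 16" if "i \<in> I" for i
    proof -
      have "dist x y \<le> 1 / real n ^ \<kappa> i" if "x \<in> V i" "y \<in> V i" for x y
        using VD[OF \<open>i \<in> I\<close>] \<kappa>(2)[OF \<open>i \<in> I\<close>] that by force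
      from card_meeting_le[OF this] show "finite (N i)" "card (N i) \<le> 16"
        unfolding N_def by simp_all
    qed
    define X where "X = (\<Union>i\<in>I. {v \<in> N i. 4 * bad_count n v \<le> length v})"
    define Y where "Y = (\<Union>k\<in>{k0..<K}. {w \<in> bad_words n k. crossed_path n w h r})"
    \<comment> \<open>All bad words of these levels are put into the cut set, whether or not they
      meet the cover, so that \<open>bad_mass\<close> controls their crossed part level by
      level.\<close>
    define S where "S = X \<union> (\<Union>k\<in>{k0..<K}. bad_words n k)"
    have fin: "finite X" "finite Y" "finite S"
      unfolding S_def X_def Y_def using I N finite_bad_words by auto
    have "1 \<le> (\<Sum>v | v \<in> S \<and> crossed_path n v h r. mass n v)"
    proof (rule mass_of_cover[OF fin(3) cr])
      fix w assume w: "length w = K" "crossed_path n w h r"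
      have wd: "set w \<subseteq> digits n" using crossed_path_imp_strip[OF w(2)] strip_subset_digits by blast
      obtain x where x: "x \<in> F" "h (address n w x) = r"
        using crossed_imp_level[OF holder_on_address[OF h \<alpha> wd] \<alpha> crossed_path_imp_crossed[OF w(2)]] by blast
      then obtain i where i: "i \<in> I" "address n w x \<in> V i"
        using cov address_F[OF wd x(1)] by blast
      define v where "v = take (\<kappa> i) w"
      define u where "u = drop (\<kappa> i) w"
      have vu: "w = v @ u" by (simp add: v_def u_def)
      have lv: "length v = \<kappa> i" using K[OF i(1)] w(1) by (simp add: v_def)
      have pv: "crossed_path n v h r" using w(2) crossed_path_append1 unfolding vu by blast
      have "address n u x \<in> F" using wd x(1) by (intro address_F) (auto simp: vu)
      then have "v \<in> N i" using i lv wd unfolding N_def vu address_append by auto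
      have "v \<in> S"
      proof (cases "4 * bad_count n v \<le> length v")
        case True
        then show ?thesis using \<open>v \<in> N i\<close> i(1) by (auto simp: S_def X_def)
      next
        case False
        then have "v \<in> bad_words n (\<kappa> i)"
          using crossed_path_imp_strip[OF pv] lv by (simp add: bad_words_def)
        then show ?thesis using K[OF i(1)] \<kappa>(1)[OF i(1)] by (auto simp: S_def)
      qed
      then show "\<exists>v\<in>S. \<exists>u. w = v @ u" using vu by blast
    qed
    also have "\<dots> \<le> sum (mass n) (X \<union> Y)"
      using fin by (intro sum_mono2) (auto simp: S_def Y_def mass_nonneg)
    also have "\<dots> \<le> sum (mass n) X + sum (mass n) Y"
      using sum.union_inter[OF fin(1,2), of "mass n"] sum_nonneg[of "X \<inter> Y" "mass n"] mass_nonneg by simp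
    also have "sum (mass n) Y \<le> (\<Sum>k=k0..<K. sum (mass n) {w \<in> bad_words n k. crossed_path n w h r})"
      unfolding Y_def using finite_bad_words mass_nonneg by (intro sum_UN_le) auto
    also have "\<dots> \<le> (\<Sum>k=k0..<K. bad_mass n h k r)"
    proof (rule sum_mono)
      fix k
      have "sum (mass n) {w \<in> bad_words n k. crossed_path n w h r}
          = (\<Sum>w | w \<in> bad_words n k \<and> crossed_path n w h r.
              mass n w * indicator {r. crossed (\<lambda>z. h (address n w z)) r} r)"
        by (intro sum.cong) (auto dest: crossed_path_imp_crossed)
      also have "\<dots> \<le> bad_mass n h k r"
        unfolding bad_mass_def using finite_bad_words
        by (intro sum_mono2) (auto intro: mass_nonneg mult_nonneg_nonneg)
      finally show "sum (mass n) {w \<in> bad_words n k. crossed_path n w h r} \<le> bad_mass n h k r" .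
    qed
    also have "\<dots> < 1/2" by (rule k0)
    also have "sum (mass n) X \<le> (\<Sum>i\<in>I. sum (mass n) {v \<in> N i. 4 * bad_count n v \<le> length v})"
      unfolding X_def using I N mass_nonneg by (intro sum_UN_le) auto
    also have "\<dots> \<le> (\<Sum>i\<in>I. 16 * 2 powr (3/2) * D i powr dim_bound)"
    proof (rule sum_mono)
      fix i assume i: "i \<in> I"
      have "sum (mass n) {v \<in> N i. 4 * bad_count n v \<le> length v}
          \<le> (\<Sum>v\<in>{v \<in> N i. 4 * bad_count n v \<le> length v}. 2 powr (- (3/2) * real (\<kappa> i)))"
      proof (rule sum_mono)
        fix v assume "v \<in> {v \<in> N i. 4 * bad_count n v \<le> length v}"
        then have "4 * bad_count n v \<le> length v" "length v = \<kappa> i" by (auto simp: N_def)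
        then show "mass n v \<le> 2 powr (- (3/2) * real (\<kappa> i))"
          using mass_le_of_few_bad[of n v] by simp
      qed
      also have "\<dots> \<le> 16 * 2 powr (- (3/2) * real (\<kappa> i))"
        using N[OF i] card_mono[OF N(1)[OF i], of "{v \<in> N i. 4 * bad_count n v \<le> length v}"]
        by (auto intro!: mult_right_mono)
      \<comment> \<open>As \<open>n powr dim_bound = 2 powr (3/2)\<close>, the mass bound is the
        power with exponent \<open>dim_bound\<close> of the side length
        \<open>1 / n ^ \<kappa> i\<close>.\<close>
      also have "2 powr (- (3/2) * real (\<kappa> i)) = (2 powr (3/2)) powr (- real (\<kappa> i))"
        by (simp add: powr_powr)
      also have "\<dots> = (1 / real n ^ \<kappa> i) powr dim_bound"
        unfolding powr_dim_bound[symmetric] using n_pos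
        by (simp add: powr_powr powr_minus powr_divide powr_realpow[symmetric] inverse_eq_divide mult.commute)
      also have "\<dots> \<le> (real n * D i) powr dim_bound"
        using \<kappa>(3)[OF i] dim_bound_pos by (intro powr_mono2) auto
      also have "\<dots> = 2 powr (3/2) * D i powr dim_bound"
        using VD[OF i] by (simp add: powr_mult powr_dim_bound)
      finally show "sum (mass n) {v \<in> N i. 4 * bad_count n v \<le> length v} \<le> 16 * 2 powr (3/2) * D i powr dim_bound"
        by simp
    qed
    also have "\<dots> = 16 * 2 powr (3/2) * (\<Sum>i\<in>I. D i powr dim_bound)"
      by (simp add: sum_distrib_left)
    finally have "1/2 < 16 * 2 powr (3/2) * (\<Sum>i\<in>I. D i powr dim_bound)" by simp
    then show "1 / (32 * 2 powr (3/2)) \<le> (\<Sum>i\<in>I. D i powr dim_bound)"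
      by (simp add: field_simps)
  qed simp
qed

text \<open>If no square of any level is crossed, \<open>digits_connected\<close> carries the side
  of \<open>r\<close> from the lower left corner of a square to those of its subsquares. Induction
  on the word, with \<open>f\<close> pulled back to the first square, reaches all levels.\<close>

lemma uncrossed_sign:
  assumes "\<And>w. set w \<subseteq> digits n \<Longrightarrow> \<not> crossed (\<lambda>z. f (address n w z)) r" "set w \<subseteq> digits n"
  shows "(f (address n w (0, 0)) \<le> r) = (f (0, 0) \<le> r)"
  using assms
proof (induction w arbitrary: f)
  case (Cons d w)
  define g where "g = (\<lambda>p. f (real (fst p) / n, real (snd p) / n) \<le> r)"
  have d: "d \<in> digits n" using Cons.prems by simp
  have "\<not> crossed (\<lambda>z. f (place n d (address n v z))) r" if "set v \<subseteq> digits n" for v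
    using Cons.prems(1)[of "d # v"] that d by simp
  from Cons.IH[OF this] Cons.prems(2)
  have "(f (address n (d # w) (0, 0)) \<le> r) = (f (place n d (0, 0)) \<le> r)" by simp
  also have "\<dots> = g (fst d, snd d)" by (simp add: g_def place_def)
  also have "\<dots> = g (0, 0)"
  proof (rule digits_connected[OF n8])
    show "\<not> mixed g d" if "d \<in> digits n" for d
      using Cons.prems(1)[of "[d]"] that unfolding g_def crossed_place_iff_mixed[symmetric] by simp
  qed (use d in simp)
  finally show ?case by (simp add: g_def)
qed simp

text \<open>Lower left corners of small squares approximate all points of \<open>F\<close>. Without
  a crossed square their values would all lie on one side of \<open>r\<close>, contradicting the
  values at \<open>x\<close> and \<open>y\<close>.\<close>

lemma crossed_word_exists:
  assumes f: "holder_on \<alpha> F f" and \<alpha>: "0 < \<alpha>"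
    and xy: "x \<in> F" "y \<in> F" "f x < r" "r < f y"
  shows "\<exists>w. set w \<subseteq> digits n \<and> crossed (\<lambda>z. f (address n w z)) r"
proof (rule ccontr)
  assume "\<not> ?thesis"
  then have sign: "(f (address n w (0, 0)) \<le> r) = (f (0, 0) \<le> r)" if "set w \<subseteq> digits n" for w
    using uncrossed_sign that by blast
  have near: "\<exists>w. set w \<subseteq> digits n \<and> \<bar>f z - f (address n w (0, 0))\<bar> < e" if z: "z \<in> F" "0 < e" for z e
  proof -
    obtain k where k: "(2 / real n ^ k) powr \<alpha> < e" using small_cells[OF \<alpha> z(2)] by blast
    obtain w z' where w: "length w = k" "set w \<subseteq> digits n" "z' \<in> F" "z = address n w z'"
      using address_cover[OF z(1)] by blast
    have "(0, 0) \<in> F" using corners_in_F by auto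
    from holder_address[OF f \<alpha> w(2,3) this] k w show ?thesis by auto
  qed
  obtain v where "set v \<subseteq> digits n" "\<bar>f x - f (address n v (0, 0))\<bar> < r - f x"
    using near[OF xy(1), of "r - f x"] xy(3) by auto
  moreover obtain w where "set w \<subseteq> digits n" "\<bar>f y - f (address n w (0, 0))\<bar> < f y - r"
    using near[OF xy(2), of "f y - r"] xy(4) by auto
  ultimately have "f (address n v (0, 0)) \<le> r" "\<not> f (address n w (0, 0)) \<le> r"
    "set v \<subseteq> digits n" "set w \<subseteq> digits n" by linarith+
  then show False using sign by blast
qed

text \<open>The lower bound is applied to \<open>f\<close> pulled back to each square; the image of
  the resulting level set is part of the level set of \<open>f\<close>. As there are only countably
  many words, the exceptional null sets can be united.\<close>

lemma AE_hausdorff_dim_level_ge: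
  assumes f: "holder_on \<alpha> F f" and \<alpha>: "0 < \<alpha>" "\<alpha> \<le> 1" and q: "42 * real n powr (3/4 - \<alpha>) \<le> 1/2"
  shows "AE r in lborel. (\<exists>x\<in>F. \<exists>y\<in>F. f x < r \<and> r < f y) \<longrightarrow>
    ereal dim_bound \<le> hausdorff_dim (level_set f F r)"
proof -
  have "AE r in lborel. set w \<subseteq> digits n \<longrightarrow> crossed (\<lambda>z. f (address n w z)) r \<longrightarrow>
      ereal dim_bound \<le> hausdorff_dim (level_set f F r)" for w
  proof (cases "set w \<subseteq> digits n")
    case True
    let ?h = "\<lambda>z. f (address n w z)"
    have h: "holder_on \<alpha> F ?h" by (rule holder_on_address[OF f \<alpha>(1) True])
    show ?thesis
      using AE_summable_bad_mass[OF h \<alpha> q]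
    proof eventually_elim
      case (elim r)
      show ?case
      proof (intro impI)
        assume "crossed ?h r"
        then have "ereal dim_bound \<le> hausdorff_dim {x \<in> F. ?h x = r}"
          using hausdorff_dim_level_ge[OF h \<alpha>(1)] elim by blast
        also have "\<dots> \<le> hausdorff_dim (level_set f F r)"
        proof (rule hausdorff_dim_le_image[where g = "address n w" and C = "real n ^ length w"])
          show "address n w ` {x \<in> F. ?h x = r} \<subseteq> level_set f F r"
            using address_F[OF True] by (auto simp: level_set_def)
        qed (use n_pos in \<open>auto simp: dist_address\<close>)
        finally show "ereal dim_bound \<le> hausdorff_dim (level_set f F r)" .
      qed
    qed
  qed simp
  then have "AE r in lborel. \<forall>w. set w \<subseteq> digits n \<longrightarrow> crossed (\<lambda>z. f (address n w z)) r \<longrightarrow>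
      ereal dim_bound \<le> hausdorff_dim (level_set f F r)"
    unfolding AE_all_countable by blast
  then show ?thesis
  proof eventually_elim
    case (elim r)
    then show ?case using crossed_word_exists[OF f \<alpha>(1)] by blast
  qed
qed

text \<open>\<open>D\<close> is abstract so that Hausdorff and lower box dimension are treated at
  once. Dominating the Hausdorff dimension gives large level sets for almost all values between the
  extremes, and vanishing on the empty set confines such values to the interval between the
  extremes.\<close>

lemma level_dim_ge:
  assumes f: "holder_on \<alpha> F f" and \<alpha>: "0 < \<alpha>" "\<alpha> \<le> 1" and q: "42 * real n powr (3/4 - \<alpha>) \<le> 1/2"
    and ne: "x0 \<in> F" "y0 \<in> F" "f x0 < f y0"
    and D: "\<And>A. A \<subseteq> F \<Longrightarrow> A \<noteq> {} \<Longrightarrow> hausdorff_dim A \<le> D A" "D {} = 0"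
  shows "ereal dim_bound \<le> level_dim D f F"
proof -
  have cont: "continuous_on F f" by (rule holder_on_imp_continuous_on[OF f \<alpha>(1)])
  obtain x where x: "x \<in> F" "\<And>z. z \<in> F \<Longrightarrow> f x \<le> f z"
    using continuous_attains_inf[OF compact_F F_nonempty cont] by blast
  obtain y where y: "y \<in> F" "\<And>z. z \<in> F \<Longrightarrow> f z \<le> f y"
    using continuous_attains_sup[OF compact_F F_nonempty cont] by blast
  have lt: "f x < f y" using x(2)[OF ne(1)] y(2)[OF ne(2)] ne(3) by linarith
  \<comment> \<open>\<open>S\<close> has to be shown measurable: \<^const>\<open>emeasure\<close> is 0 on nonmeasurable sets.\<close>
  define S where "S = {r. ereal dim_bound \<le> D (level_set f F r)}"
  define T where "T = {f x<..<f y}"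
  have sub: "S \<subseteq> {f x..f y}"
  proof
    fix r assume "r \<in> S"
    have "level_set f F r \<noteq> {}"
    proof
      assume "level_set f F r = {}"
      then have "ereal dim_bound \<le> 0" using \<open>r \<in> S\<close> D(2) by (simp add: S_def)
      then show False using dim_bound_pos by (simp add: zero_ereal_def)
    qed
    then show "r \<in> {f x..f y}" using x y by (auto simp: level_set_def)
  qed
  obtain N where N: "N \<in> null_sets lborel" and
    Nsub: "{r \<in> space lborel. \<not> ((\<exists>x\<in>F. \<exists>y\<in>F. f x < r \<and> r < f y) \<longrightarrow>
      ereal dim_bound \<le> hausdorff_dim (level_set f F r))} \<subseteq> N"
    using AE_hausdorff_dim_level_ge[OF f \<alpha> q] by (rule AE_E3) blast
  have "T - S \<subseteq> N"
  proof
    fix r assume r: "r \<in> T - S"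
    then have "\<exists>x\<in>F. \<exists>y\<in>F. f x < r \<and> r < f y" using x(1) y(1) by (auto simp: T_def)
    moreover have "\<not> ereal dim_bound \<le> hausdorff_dim (level_set f F r)"
    proof
      assume le: "ereal dim_bound \<le> hausdorff_dim (level_set f F r)"
      have "level_set f F r \<noteq> {}"
        using le dim_bound_pos by (auto simp: hausdorff_dim_empty zero_ereal_def)
      then have "hausdorff_dim (level_set f F r) \<le> D (level_set f F r)"
        by (intro D(1)) (auto simp: level_set_def)
      then show False using le r by (auto simp: S_def)
    qed
    ultimately show "r \<in> N" using Nsub by auto
  qed
  then have TS: "T - S \<in> null_sets lebesgue"
    using N null_sets_completion_iff2 by blast
  have "S - T \<subseteq> {f x, f y}" using sub by (auto simp: T_def)
  moreover have "{f x, f y} \<in> null_sets lborel" by (auto intro: finite_imp_null_set_lborel)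
  ultimately have ST: "S - T \<in> null_sets lebesgue" using null_sets_completion_iff2 by blast
  have Tm: "T \<in> sets lebesgue" by (simp add: T_def)
  have "S = (T - (T - S)) \<union> (S - T)" by blast
  then have Sm: "S \<in> sets lebesgue" using Tm TS ST by (metis null_setsD2 sets.Diff sets.Un)
  have "emeasure lebesgue T = ennreal (f y - f x)"
    unfolding T_def using lt by simp
  then have "0 < emeasure lebesgue T" using lt by simp
  also have "emeasure lebesgue T = emeasure lebesgue (T - (T - S))"
    using emeasure_Diff_null_set[OF TS Tm] by simp
  also have "\<dots> \<le> emeasure lebesgue S"
    using Sm by (intro emeasure_mono) auto
  finally show ?thesis
    unfolding level_dim_def S_def by (intro Sup_upper) auto
qed

end


section \<open>Generic functions\<close>

lemma mspace_holder_space_iff: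
  "f \<in> mspace (holder_space \<alpha> F) \<longleftrightarrow> f \<in> mspace (funspace F euclidean_metric) \<and> holder_on \<alpha> F f"
  by (auto simp: holder_space_def holder_on_def)

lemma mdist_holder_space_le_iff:
  assumes "f \<in> mspace (holder_space \<alpha> F)" "g \<in> mspace (holder_space \<alpha> F)" "F \<noteq> {}"
  shows "mdist (holder_space \<alpha> F) f g \<le> e \<longleftrightarrow> (\<forall>x\<in>F. \<bar>f x - g x\<bar> \<le> e)"
  using funspace_mdist_le[of f F euclidean_metric g e] assms
  by (simp add: holder_space_def dist_real_def)

lemma holder_on_imp_mspace:
  assumes F: "compact F" and g: "holder_on \<alpha> F g" "0 < \<alpha>"
  shows "restrict g F \<in> mspace (holder_space \<alpha> F)"
proof -
  have "bounded (g ` F)"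
    using compact_continuous_image[OF holder_on_imp_continuous_on[OF g] F] compact_imp_bounded by blast
  then have "restrict g F \<in> mspace (funspace F euclidean_metric)"
    by (simp add: Met_TC.fspace_def)
  moreover have "holder_on \<alpha> F (restrict g F)" using g(1) by (simp add: holder_on_def)
  ultimately show ?thesis by (simp add: mspace_holder_space_iff)
qed

lemma openin_holder_space_separating:
  assumes "x \<in> F" "y \<in> F"
  shows "openin (mtopology_of (holder_space \<alpha> F)) {f \<in> mspace (holder_space \<alpha> F). f x \<noteq> f y}"
proof -
  interpret M: Metric_space "mspace (holder_space \<alpha> F)" "mdist (holder_space \<alpha> F)"
    by (rule Metric_space_mspace_mdist)
  show ?thesis
    unfolding mtopology_of_def M.openin_mtopology
  proof (intro conjI allI impI)
    fix f assume "f \<in> {f \<in> mspace (holder_space \<alpha> F). f x \<noteq> f y}"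
    then have f: "f \<in> mspace (holder_space \<alpha> F)" "f x \<noteq> f y" by auto
    define e where "e = \<bar>f x - f y\<bar> / 2"
    have "g x \<noteq> g y" if g: "g \<in> M.mball f e" for g
    proof
      assume eq: "g x = g y"
      have "mdist (holder_space \<alpha> F) f g < e" "g \<in> mspace (holder_space \<alpha> F)" using g by auto
      then have "\<forall>z\<in>F. \<bar>f z - g z\<bar> \<le> mdist (holder_space \<alpha> F) f g"
        using mdist_holder_space_le_iff[OF f(1), of g] assms by blast
      then have "\<bar>f x - g x\<bar> < e" "\<bar>f y - g y\<bar> < e"
        using assms \<open>mdist (holder_space \<alpha> F) f g < e\<close> by fastforce+
      moreover have "\<bar>f x - f y\<bar> \<le> \<bar>f x - g x\<bar> + \<bar>f y - g y\<bar>"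
        using eq abs_triangle_ineq4[of "f x - g x" "f y - g y"] by simp
      ultimately show False by (simp add: e_def)
    qed
    moreover have "0 < e" using f(2) by (simp add: e_def)
    ultimately show "\<exists>r>0. M.mball f r \<subseteq> {f \<in> mspace (holder_space \<alpha> F). f x \<noteq> f y}"
      by (intro exI[of _ e]) auto
  qed auto
qed

section \<open>Density of the separating functions\<close>

context grid_fractal
begin

text \<open>The first coordinate is 1-Lipschitz and varies by at most 1 on the unit square, where
  \<open>t \<le> t powr \<alpha>\<close>.\<close>

lemma holder_on_fst:
  assumes "\<alpha> \<le> 1" "0 < \<alpha>"
  shows "holder_on \<alpha> F fst"
  unfolding holder_on_def
proof (intro ballI)
  fix a b assume ab: "a \<in> F" "b \<in> F"
  define t where "t = \<bar>fst a - fst b\<bar>"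
  have "a \<in> unit_square" "b \<in> unit_square" using ab F_subset by auto
  then have t: "0 \<le> t" "t \<le> 1" by (auto simp: t_def unit_square_def)
  have "t powr 1 \<le> t powr \<alpha>" using t assms by (intro powr_mono') auto
  also have "t powr 1 = t" using t by simp
  also have "t powr \<alpha> \<le> dist a b powr \<alpha>"
    using dist_fst_le[of a b] t assms by (intro powr_mono2) (auto simp: t_def dist_real_def)
  finally show "\<bar>fst a - fst b\<bar> \<le> dist a b powr \<alpha>" by (simp add: t_def)
qed

lemma holder_on_convex:
  assumes "holder_on \<alpha> S f" "holder_on \<alpha> S g" "0 \<le> \<delta>" "\<delta> \<le> 1"
  shows "holder_on \<alpha> S (\<lambda>x. (1 - \<delta>) * f x + \<delta> * g x)"
  unfolding holder_on_def
proof (intro ballI)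
  fix a b assume ab: "a \<in> S" "b \<in> S"
  have "\<bar>((1 - \<delta>) * f a + \<delta> * g a) - ((1 - \<delta>) * f b + \<delta> * g b)\<bar>
      = \<bar>(1 - \<delta>) * (f a - f b) + \<delta> * (g a - g b)\<bar>" by (simp add: algebra_simps)
  also have "\<dots> \<le> (1 - \<delta>) * \<bar>f a - f b\<bar> + \<delta> * \<bar>g a - g b\<bar>"
    using assms by (intro order.trans[OF abs_triangle_ineq]) (simp add: abs_mult)
  also have "\<dots> \<le> (1 - \<delta>) * dist a b powr \<alpha> + \<delta> * dist a b powr \<alpha>"
    using assms ab by (intro add_mono mult_left_mono) (auto simp: holder_on_def)
  finally show "\<bar>((1 - \<delta>) * f a + \<delta> * g a) - ((1 - \<delta>) * f b + \<delta> * g b)\<bar> \<le> dist a b powr \<alpha>"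
    by (simp add: algebra_simps)
qed

text \<open>Density comes from moving \<open>f\<close> slightly towards the coordinate function
  \<open>fst\<close>, which separates the two corners. A convex combination is used because it
  preserves the Hoelder constant 1.\<close>

lemma separating_dense_gdelta:
  assumes \<alpha>: "0 < \<alpha>" "\<alpha> \<le> 1"
  shows "{f \<in> mspace (holder_space \<alpha> F). f (0, 0) \<noteq> f (1, 0)} \<in> dense_gdeltas \<alpha> F" (is "?G \<in> _")
proof -
  interpret M: Metric_space "mspace (holder_space \<alpha> F)" "mdist (holder_space \<alpha> F)"
    by (rule Metric_space_mspace_mdist)
  have c: "(0, 0) \<in> F" "(1, 0) \<in> F" using corners_in_F by auto
  have "\<exists>g\<in>?G. g \<in> M.mball f e" if f: "f \<in> mspace (holder_space \<alpha> F)" and e: "0 < e" for f e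
  proof (cases "f (0, 0) = f (1, 0)")
    case False
    then show ?thesis using f e by (intro bexI[of _ f]) auto
  next
    case True
    have hf: "holder_on \<alpha> F f" using f by (simp add: mspace_holder_space_iff)
    have "bounded (f ` F)"
      using compact_continuous_image[OF holder_on_imp_continuous_on[OF hf \<alpha>(1)] compact_F]
        compact_imp_bounded by blast
    then obtain B where B: "0 < B" "\<And>x. x \<in> F \<Longrightarrow> \<bar>f x\<bar> \<le> B"
      unfolding bounded_pos by auto
    \<comment> \<open>The perturbation moves values by
      \<open>\<delta> * \<bar>f x - fst x\<bar>\<close>, at most \<open>\<delta> * (1 + B)\<close>,
      so this choice keeps it within \<open>e / 2\<close>; the cap at 1 keeps the combination
      convex.\<close>
    define \<delta> where "\<delta> = min 1 (e / (2 * (1 + B)))"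
    have \<delta>: "0 < \<delta>" "\<delta> \<le> 1" "\<delta> \<le> e / (2 * (1 + B))"
      using e B(1) by (auto simp: \<delta>_def)
    have \<delta>B: "\<delta> * (1 + B) \<le> e / 2"
      using \<delta>(3) B(1) by (simp add: pos_le_divide_eq algebra_simps)
    define g where "g = restrict (\<lambda>x. (1 - \<delta>) * f x + \<delta> * fst x) F"
    have gm: "g \<in> mspace (holder_space \<alpha> F)"
      unfolding g_def
      by (rule holder_on_imp_mspace[OF compact_F holder_on_convex[OF hf holder_on_fst[OF \<alpha>(2,1)]] \<alpha>(1)])
        (use \<delta> in auto)
    have "\<bar>f x - g x\<bar> \<le> e / 2" if x: "x \<in> F" for x
    proof -
      have "x \<in> unit_square" using x F_subset by auto
      then have "\<bar>fst x\<bar> \<le> 1" by (auto simp: unit_square_def)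
      then have "\<bar>f x - fst x\<bar> \<le> 1 + B" using B(2)[OF x] by linarith
      then have "\<delta> * \<bar>f x - fst x\<bar> \<le> \<delta> * (1 + B)" using \<delta>(1) by (intro mult_left_mono) auto
      moreover have "f x - g x = \<delta> * (f x - fst x)" using x by (simp add: g_def algebra_simps)
      then have "\<bar>f x - g x\<bar> = \<delta> * \<bar>f x - fst x\<bar>" using \<delta>(1) by (simp add: abs_mult)
      ultimately show ?thesis using \<delta>B by linarith
    qed
    then have "mdist (holder_space \<alpha> F) f g \<le> e / 2"
      using mdist_holder_space_le_iff[OF f gm F_nonempty] by blast
    then have "g \<in> M.mball f e" using f gm e by simp
    moreover have "g \<in> ?G" using gm c True \<delta>(1) by (simp add: g_def)
    ultimately show ?thesis by blast
  qed
  then have "mtopology_of (holder_space \<alpha> F) closure_of ?G = mspace (holder_space \<alpha> F)"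
    unfolding mtopology_of_def M.metric_closure_of by blast
  moreover have "gdelta_in (mtopology_of (holder_space \<alpha> F)) ?G"
    by (rule open_imp_gdelta_in[OF openin_holder_space_separating[OF c]])
  ultimately show ?thesis by (simp add: dense_gdeltas_def)
qed

text \<open>The supremum over dense G-delta sets is bounded below by the single set of functions
  that separate two corners.\<close>

lemma generic_level_dim_ge:
  assumes \<alpha>: "0 < \<alpha>" "\<alpha> \<le> 1" and q: "42 * real n powr (3/4 - \<alpha>) \<le> 1/2"
    and D: "\<And>A. A \<subseteq> F \<Longrightarrow> A \<noteq> {} \<Longrightarrow> hausdorff_dim A \<le> D A" "D {} = 0"
  shows "ereal dim_bound \<le> generic_level_dim D \<alpha> F"
  unfolding generic_level_dim_def
proof (rule SUP_upper2[OF separating_dense_gdelta[OF \<alpha>]], rule INF_greatest)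
  fix f assume f: "f \<in> {f \<in> mspace (holder_space \<alpha> F). f (0, 0) \<noteq> f (1, 0)}"
  then have hf: "holder_on \<alpha> F f" by (simp add: mspace_holder_space_iff)
  have c: "(0, 0) \<in> F" "(1, 0) \<in> F" using corners_in_F by auto
  show "ereal dim_bound \<le> level_dim D f F"
  proof (cases "f (0, 0) < f (1, 0)")
    case True
    show ?thesis by (rule level_dim_ge[OF hf \<alpha> q c True D])
  next
    case False
    then have "f (1, 0) < f (0, 0)" using f by auto
    then show ?thesis by (rule level_dim_ge[OF hf \<alpha> q c(2,1) _ D])
  qed
qed

end

text \<open>The constants 56 and 7/8 serve the smallness condition: \<open>3/4 - \<alpha>\<close> is
  below \<open>- 1/8\<close>, so \<open>2 powr (m * (3/4 - \<alpha>))\<close> is at most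
  \<open>2 powr (- 7) = 1/128\<close>, and \<open>42/128 \<le> 1/2\<close>. The strict inequality
  comes from \<open>dim_bound = 3/2 / m\<close>.\<close>

lemma boxplus_generic_level_dim:
  assumes m: "56 \<le> m" and \<alpha>: "\<alpha> \<in> {7/8<..1}"
    and D: "\<And>A. A \<subseteq> boxplus m \<Longrightarrow> A \<noteq> {} \<Longrightarrow> hausdorff_dim A \<le> D A" "D {} = 0"
  shows "ereal (1 / real m) < generic_level_dim D \<alpha> (boxplus m)"
proof -
  interpret grid_fractal "2 ^ m" "boxplus m" by (rule grid_fractal_boxplus) (use m in simp)
  have "real (2 ^ m) powr (3/4 - \<alpha>) = 2 powr (real m * (3/4 - \<alpha>))"
    by (simp add: powr_powr flip: powr_realpow)
  also have "real m * (3/4 - \<alpha>) \<le> 56 * (- 1/8)"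
  proof -
    have "56 * (1/8) \<le> real m * (\<alpha> - 3/4)"
      using m \<alpha> by (intro mult_mono) auto
    then show ?thesis by (simp add: algebra_simps)
  qed
  then have "2 powr (real m * (3/4 - \<alpha>)) \<le> 2 powr (56 * (- 1/8) :: real)"
    by (intro powr_mono) auto
  also have "\<dots> = 1/128" by (simp add: powr_minus powr_numeral)
  finally have q: "42 * real (2 ^ m) powr (3/4 - \<alpha>) \<le> 1/2" by simp
  have "dim_bound = 3/2 / real m"
    using m by (simp add: dim_bound_def ln_realpow)
  then have "ereal (1 / real m) < ereal dim_bound"
    using m by (simp add: field_simps)
  also have "\<dots> \<le> generic_level_dim D \<alpha> (boxplus m)"
    using \<alpha> by (intro generic_level_dim_ge[OF _ _ q D]) auto
  finally show ?thesis .
qed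

theorem theorem5p6:
  shows "\<exists>m0\<ge>1. \<forall>m::nat. m \<ge> m0 \<longrightarrow>
           (\<exists>\<alpha>1::real. 0 < \<alpha>1 \<and> \<alpha>1 < 1 \<and>
              (\<forall>\<alpha>\<in>{\<alpha>1<..1}. D_hausdorff \<alpha> (boxplus m) > ereal (1 / real m))) \<and>
           (\<exists>\<alpha>1::real. 0 < \<alpha>1 \<and> \<alpha>1 < 1 \<and>
              (\<forall>\<alpha>\<in>{\<alpha>1<..1}. D_lower_box \<alpha> (boxplus m) > ereal (1 / real m)))"
proof -
  have H: "D_hausdorff \<alpha> (boxplus m) > ereal (1 / real m)" if "56 \<le> m" "\<alpha> \<in> {7/8<..1}" for m \<alpha>
    unfolding D_hausdorff_def
    by (rule boxplus_generic_level_dim[OF that]) (auto simp: hausdorff_dim_empty)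
  have L: "D_lower_box \<alpha> (boxplus m) > ereal (1 / real m)" if "56 \<le> m" "\<alpha> \<in> {7/8<..1}" for m \<alpha>
    unfolding D_lower_box_def
  proof (rule boxplus_generic_level_dim[OF that])
    interpret grid_fractal "2 ^ m" "boxplus m" by (rule grid_fractal_boxplus) (use that in simp)
    show "hausdorff_dim A \<le> lower_box_dim A" if "A \<subseteq> boxplus m" "A \<noteq> {}" for A
      using that bounded_subset[OF compact_imp_bounded[OF compact_F]]
      by (intro hausdorff_dim_le_lower_box_dim) auto
  qed (simp add: lower_box_dim_def)
  show ?thesis
    by (intro exI[of _ 56] conjI allI impI exI[of _ "7/8"] ballI) (simp_all add: H L)
qed


end
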